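(* Let $n \geq 2$ and let $S_{n+1}^1$ be the augmented star on $n+1$ vertices. Then: (1) If $G_1, G_2$ are two simple graphs on $k$ vertices with $X_{G_1}^{S_{n+1}^1} = X_{G_2}^{S_{n+1}^1}$, then $G_1, G_2$ have the same number of edges. (2) All simple graphs in $\mathcal{G}_m := \{\overline{G} \mid |V(G)| = k,\ |E(G)| = m,\ G \text{ is } C_3\text{-free}\}$ have the same $S_{n+1}^1$-chromatic symmetric function, which is not equal to the $S_{n+1}^1$-chromatic symmetric function of any simple graph not in $\mathcal{G}_m$. (3) For each $1 \leq j \leq k$, all graphs in $\mathcal{T}_j := \{\overline{T} \mid T \text{ is a forest on } k \text{ vertices with } j \text{ connected components}\}$ have the same $S_{n+1}^1$-chromatic symmetric function. In particular, all complements of trees on the same number of vertices have the same $S_{n+1}^1$-chromatic symmetric function.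
   Context: Graphs are finite and undirected with at least one vertex. The graphs $G$ being colored are simple; the coloring graph $H$ may have loops, and a vertex with a loop is adjacent to itself. $\overline{G}$ is the complement of a simple graph $G$; $C_3$-free means containing no (induced) triangle; a forest is an acyclic graph. The augmented star $S_{n+1}^1$ is the star $K_{1,n}$ (one center, $n$ leaves) with one extra loop at its center. $H$-chromatic symmetric function: let $|V(G)|=k$, $|V(H)|=N$. A labeling of $H$ is a bijection $\phi:V(H)\to[N]$. A proper $(H,\phi)$-coloring of $G$ is a map $\kappa:V(G)\to[N]$ such that whenever $u,v$ are adjacent in $G$, $\phi^{-1}(\kappa(u))$ and $\phi^{-1}(\kappa(v))$ are adjacent in $H$. Put $w_G^H=\sum_\phi\sum_\kappa\prod_{v\in V(G)}x_{\kappa(v)}$, summed over all labelings $\phi$ and all proper $(H,\phi)$-colorings $\kappa$. This is a symmetric polynomial in $x_1,\dots,x_N$, homogeneous of degree $k$; writing $w_G^H=\sum_{\lambda\vdash k,\,l(\lambda)\le N}c_\lambda m_\lambda(x_1,\dots,x_N)$ (with $m_\lambda$ the monomial symmetric functions and $l(\lambda)$ the number of parts), define $X_G^H=\sum_{\lambda\vdash k,\,l(\lambda)\le N}c_\lambda m_\lambda\in\Lambda^k$. *)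

theory Defs
  imports
    "Graph_Theory.Graph_Theory"
    "HOL-Library.Poly_Mapping"
    "HOL-Library.Multiset"
    "HOL-Library.FuncSet"
    "HOL-Combinatorics.Combinatorics"
begin

section \<open>Graphs\<close>

text \<open>
  An undirected graph is a symmetric pair digraph: an edge joining \<open>u\<close> and \<open>v\<close> is the pair of
  arcs \<open>(u, v)\<close>, \<open>(v, u)\<close>, and a loop at \<open>v\<close> is the single arc \<open>(v, v)\<close>. Graphs with loops are
  \<^locale>\<open>pair_pseudo_graph\<close>, loop-free ones are \<^locale>\<open>pair_graph\<close>.
\<close>

definition simple_graph :: "'a pair_pre_digraph \<Rightarrow> bool" where
  "simple_graph G \<longleftrightarrow> pair_graph G \<and> pverts G \<noteq> {}"

definition uedges :: "'a pair_pre_digraph \<Rightarrow> 'a set set" where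
  "uedges G = {{u, v} | u v. (u, v) \<in> parcs G}"

definition complement :: "'a pair_pre_digraph \<Rightarrow> 'a pair_pre_digraph" where
  "complement G = \<lparr> pverts = pverts G,
     parcs = {(u, v). u \<in> pverts G \<and> v \<in> pverts G \<and> u \<noteq> v \<and> (u, v) \<notin> parcs G} \<rparr>"

definition C3_free :: "'a pair_pre_digraph \<Rightarrow> bool" where
  "C3_free G \<longleftrightarrow> \<not> (\<exists>u v w. distinct [u, v, w] \<and>
     (u, v) \<in> parcs G \<and> (v, w) \<in> parcs G \<and> (w, u) \<in> parcs G)"

text \<open>
  The library constants \<^const>\<open>forest\<close> and \<^const>\<open>tree\<close> do not describe undirected forests and
  trees here: they forbid all directed cycles, and every edge of a symmetric digraph yields the
  directed cycle \<open>u, v, u\<close> of length 2. The cycles of a simple undirected graph are the directed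
  cycles of length at least 3.
\<close>

definition undirected_forest :: "'a pair_pre_digraph \<Rightarrow> bool" where
  "undirected_forest G \<longleftrightarrow> simple_graph G \<and>
     \<not> (\<exists>p. pre_digraph.cycle (with_proj G) p \<and> 3 \<le> length p)"

definition undirected_tree :: "'a pair_pre_digraph \<Rightarrow> bool" where
  "undirected_tree G \<longleftrightarrow> undirected_forest G \<and> connected (with_proj G)"

text \<open>In a symmetric digraph the strongly connected components are the connected components.\<close>

definition components :: "'a pair_pre_digraph \<Rightarrow> 'a set set" where
  "components G = pre_digraph.sccs_verts (with_proj G)"

text \<open>The center is \<open>0\<close>, the leaves are \<open>1, \<dots>, n\<close>.\<close>

definition aug_star :: "nat \<Rightarrow> nat pair_pre_digraph" where
  "aug_star n = \<lparr> pverts = {0..n},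
     parcs = {(0, 0)} \<union> {(0, i) | i. i \<in> {1..n}} \<union> {(i, 0) | i. i \<in> {1..n}} \<rparr>"

definition co_C3_free_graphs :: "nat \<Rightarrow> nat \<Rightarrow> 'a pair_pre_digraph set" where
  "co_C3_free_graphs k m = {complement G | G.
     simple_graph G \<and> card (pverts G) = k \<and> card (uedges G) = m \<and> C3_free G}"

definition co_forests :: "nat \<Rightarrow> nat \<Rightarrow> 'a pair_pre_digraph set" where
  "co_forests k j = {complement T | T.
     undirected_forest T \<and> card (pverts T) = k \<and> card (components T) = j}"

section \<open>Symmetric polynomials and symmetric functions\<close>

text \<open>
  The variables are \<open>x\<^sub>1, x\<^sub>2, \<dots>\<close>. A monomial is given by its exponent map, a polynomial is a
  finitely supported map from monomials to coefficients, and a symmetric function is represented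
  by its coefficients as a formal power series.
\<close>

type_synonym monom = "nat \<Rightarrow>\<^sub>0 nat"
type_synonym polynomial = "monom \<Rightarrow>\<^sub>0 int"
type_synonym symfun = "monom \<Rightarrow> int"

definition xvar :: "nat \<Rightarrow> polynomial" where
  "xvar i = Poly_Mapping.single (Poly_Mapping.single i 1) 1"

definition exponents :: "monom \<Rightarrow> nat multiset" where
  "exponents \<alpha> = image_mset (Poly_Mapping.lookup \<alpha>) (mset_set (Poly_Mapping.keys \<alpha>))"

text \<open>
  Partitions of \<open>k\<close> with at most \<open>N\<close> parts, as multisets of positive parts.
\<close>

definition partitions_le :: "nat \<Rightarrow> nat \<Rightarrow> nat multiset set" where
  "partitions_le k N = {\<mu>. 0 \<notin># \<mu> \<and> sum_mset \<mu> = k \<and> size \<mu> \<le> N}"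

text \<open>
  \<open>msym I \<mu>\<close> is the monomial symmetric function in the variables \<open>x\<^sub>i\<close> with \<open>i \<in> I\<close>; thus
  \<open>msym {1..N} \<mu>\<close> is \<open>m\<^sub>\<mu>(x\<^sub>1, \<dots>, x\<^sub>N)\<close> and \<open>msym {1..} \<mu>\<close> is \<open>m\<^sub>\<mu>\<close>.
\<close>

definition msym :: "nat set \<Rightarrow> nat multiset \<Rightarrow> symfun" where
  "msym I \<mu> \<alpha> = (if Poly_Mapping.keys \<alpha> \<subseteq> I \<and> exponents \<alpha> = \<mu> then 1 else 0)"

definition m_expansion :: "nat \<Rightarrow> nat \<Rightarrow> polynomial \<Rightarrow> (nat multiset \<Rightarrow> int) \<Rightarrow> bool" where
  "m_expansion k N f c \<longleftrightarrow>
     (\<forall>\<mu>. \<mu> \<notin> partitions_le k N \<longrightarrow> c \<mu> = 0) \<and>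
     (\<forall>\<alpha>. Poly_Mapping.lookup f \<alpha> = (\<Sum>\<mu>\<in>partitions_le k N. c \<mu> * msym {1..N} \<mu> \<alpha>))"

lemma finite_partitions_le: "finite (partitions_le k N)"
proof -
  have "partitions_le k N \<subseteq> mset ` {xs. set xs \<subseteq> {..k} \<and> length xs \<le> N}"
  proof
    fix M assume M: "M \<in> partitions_le k N"
    obtain xs where xs: "M = mset xs" by (metis ex_mset)
    have "set xs \<subseteq> {..k}" "length xs \<le> N"
      using M xs by (auto simp: partitions_le_def sum_mset_sum_list intro: member_le_sum_list)
    then show "M \<in> mset ` {xs. set xs \<subseteq> {..k} \<and> length xs \<le> N}" using xs by auto
  qed
  then show ?thesis
    by (rule finite_subset) (intro finite_imageI finite_lists_length_le finite_atMost)
qed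

lemma sum_msym:
  "(\<Sum>\<mu>\<in>partitions_le k N. c \<mu> * msym I \<mu> \<alpha>) =
     (if Poly_Mapping.keys \<alpha> \<subseteq> I \<and> exponents \<alpha> \<in> partitions_le k N then c (exponents \<alpha>) else 0)"
proof -
  have "(\<Sum>\<mu>\<in>partitions_le k N. c \<mu> * msym I \<mu> \<alpha>) =
      (\<Sum>\<mu>\<in>partitions_le k N. if exponents \<alpha> = \<mu> then (if Poly_Mapping.keys \<alpha> \<subseteq> I then c \<mu> else 0) else 0)"
    by (rule sum.cong) (auto simp: msym_def)
  also have "\<dots> = (if exponents \<alpha> \<in> partitions_le k N then
      (if Poly_Mapping.keys \<alpha> \<subseteq> I then c (exponents \<alpha>) else 0) else 0)"
    by (rule sum.delta'[OF finite_partitions_le])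
  finally show ?thesis by auto
qed

lemma exponents_surj:
  assumes "0 \<notin># M" "size M \<le> N"
  obtains \<alpha> where "Poly_Mapping.keys \<alpha> \<subseteq> {1..N}" "exponents \<alpha> = M"
proof -
  obtain xs where xs: "M = mset xs" by (metis ex_mset)
  let ?f = "\<lambda>i. if i \<in> {1..length xs} then xs ! (i - 1) else 0"
  have fin: "finite {i. ?f i \<noteq> 0}" by (rule finite_subset[of _ "{1..length xs}"]) auto
  define \<alpha> where "\<alpha> = Abs_poly_mapping ?f"
  have l: "Poly_Mapping.lookup \<alpha> = ?f"
    unfolding \<alpha>_def using fin by (intro lookup_Abs_poly_mapping)
  have nz: "xs ! i \<noteq> 0" if "i < length xs" for i
    using assms(1) xs that by (metis in_multiset_in_set nth_mem)
  have k: "Poly_Mapping.keys \<alpha> = {1..length xs}"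
    using nz by (auto simp: in_keys_iff l split: if_splits)
  have "exponents \<alpha> = image_mset ?f (mset_set {1..length xs})"
    by (simp add: exponents_def k l)
  also have "\<dots> = image_mset ?f (image_mset Suc (mset_set {0..<length xs}))"
    by (subst image_mset_mset_set) (auto simp: image_Suc_atLeastLessThan atLeastLessThanSuc_atLeastAtMost)
  also have "\<dots> = image_mset (\<lambda>i. xs ! i) (mset_set {0..<length xs})"
    by (simp add: multiset.map_comp o_def) (rule image_mset_cong, auto)
  also have "\<dots> = mset (map (\<lambda>i. xs ! i) [0..<length xs])"
    by (simp only: mset_map mset_upt)
  also have "\<dots> = M" by (simp only: map_nth xs)
  finally have "exponents \<alpha> = M" .
  moreover have "Poly_Mapping.keys \<alpha> \<subseteq> {1..N}" using assms(2) xs by (auto simp: k)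
  ultimately show thesis using that by blast
qed

section \<open>The \<open>H\<close>-chromatic symmetric function\<close>

text \<open>
  Labelings and colorings are extensional, so that each is counted once.
\<close>

definition labelings :: "'h pair_pre_digraph \<Rightarrow> ('h \<Rightarrow> nat) set" where
  "labelings H = {\<phi> \<in> extensional (pverts H). bij_betw \<phi> (pverts H) {1..card (pverts H)}}"

definition proper_colorings ::
  "'h pair_pre_digraph \<Rightarrow> ('h \<Rightarrow> nat) \<Rightarrow> 'a pair_pre_digraph \<Rightarrow> ('a \<Rightarrow> nat) set" where
  "proper_colorings H \<phi> G = {\<kappa> \<in> pverts G \<rightarrow>\<^sub>E {1..card (pverts H)}.
     \<forall>u v. (u, v) \<in> parcs G \<longrightarrow>
       (inv_into (pverts H) \<phi> (\<kappa> u), inv_into (pverts H) \<phi> (\<kappa> v)) \<in> parcs H}"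

definition chrom_poly :: "'h pair_pre_digraph \<Rightarrow> 'a pair_pre_digraph \<Rightarrow> polynomial" where
  "chrom_poly H G =
     (\<Sum>\<phi>\<in>labelings H. \<Sum>\<kappa>\<in>proper_colorings H \<phi> G. \<Prod>v\<in>pverts G. xvar (\<kappa> v))"

definition chrom_sym :: "'h pair_pre_digraph \<Rightarrow> 'a pair_pre_digraph \<Rightarrow> symfun" where
  "chrom_sym H G = (let k = card (pverts G); N = card (pverts H);
       c = (THE c. m_expansion k N (chrom_poly H G) c)
     in (\<lambda>\<alpha>. \<Sum>\<mu>\<in>partitions_le k N. c \<mu> * msym {1..} \<mu> \<alpha>))"

definition coloring_monom :: "'a pair_pre_digraph \<Rightarrow> ('a \<Rightarrow> nat) \<Rightarrow> monom" where
  "coloring_monom G \<kappa> = (\<Sum>v\<in>pverts G. Poly_Mapping.single (\<kappa> v) 1)"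

lemma lookup_coloring_monom:
  assumes "finite (pverts G)"
  shows "Poly_Mapping.lookup (coloring_monom G \<kappa>) i = card {v \<in> pverts G. \<kappa> v = i}"
proof -
  have "Poly_Mapping.lookup (coloring_monom G \<kappa>) i = (\<Sum>v\<in>pverts G. if \<kappa> v = i then 1 else 0)"
    by (auto simp: coloring_monom_def lookup_sum lookup_single when_def intro: sum.cong)
  also have "\<dots> = card {v \<in> pverts G. \<kappa> v = i}"
    using assms by (simp add: sum.If_cases Int_def)
  finally show ?thesis .
qed

lemma prod_xvar:
  assumes "finite (pverts G)"
  shows "(\<Prod>v\<in>pverts G. xvar (\<kappa> v)) = Poly_Mapping.single (coloring_monom G \<kappa>) 1"
proof -
  have "(\<Prod>v\<in>A. xvar (\<kappa> v)) =
      Poly_Mapping.single (\<Sum>v\<in>A. Poly_Mapping.single (\<kappa> v) 1) 1" if "finite A" for A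
    using that by (induction A) (simp_all add: xvar_def mult_single)
  then show ?thesis using assms by (simp add: coloring_monom_def)
qed

lemma finite_labelings: "finite (pverts H) \<Longrightarrow> finite (labelings H)"
  by (rule finite_subset[of _ "pverts H \<rightarrow>\<^sub>E {1..card (pverts H)}"])
     (auto simp: labelings_def PiE_iff extensional_def dest: bij_betwE intro: finite_PiE)

lemma finite_proper_colorings: "finite (pverts G) \<Longrightarrow> finite (proper_colorings H \<phi> G)"
  by (rule finite_subset[of _ "pverts G \<rightarrow>\<^sub>E {1..card (pverts H)}"])
     (auto simp: proper_colorings_def intro: finite_PiE)

lemma lookup_chrom_poly:
  assumes "finite (pverts G)" "finite (pverts H)"
  shows "Poly_Mapping.lookup (chrom_poly H G) \<alpha> =
    (\<Sum>(\<phi>, \<kappa>)\<in>Sigma (labelings H) (\<lambda>\<phi>. proper_colorings H \<phi> G).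
       if coloring_monom G \<kappa> = \<alpha> then 1 else 0)"
proof -
  have "Poly_Mapping.lookup (chrom_poly H G) \<alpha> =
    (\<Sum>\<phi>\<in>labelings H. \<Sum>\<kappa>\<in>proper_colorings H \<phi> G. if coloring_monom G \<kappa> = \<alpha> then 1 else 0)"
    using assms(1)
    by (auto simp: chrom_poly_def prod_xvar lookup_sum lookup_single when_def intro!: sum.cong)
  then show ?thesis
    using assms by (simp add: sum.Sigma finite_labelings finite_proper_colorings)
qed

lemma relabel_mem:
  assumes p: "p permutes {1..card (pverts H)}" and wf: "pair_wf_digraph G"
    and D: "\<phi> \<in> labelings H" "\<kappa> \<in> proper_colorings H \<phi> G"
  shows "restrict (p \<circ> \<phi>) (pverts H) \<in> labelings H"
    and "restrict (p \<circ> \<kappa>) (pverts G) \<in> proper_colorings H (restrict (p \<circ> \<phi>) (pverts H)) G"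
proof -
  let ?V = "pverts H" and ?N = "card (pverts H)"
  let ?\<phi> = "restrict (p \<circ> \<phi>) (pverts H)"
  have \<phi>: "bij_betw \<phi> ?V {1..?N}" using D by (simp add: labelings_def)
  have b: "bij_betw (p \<circ> \<phi>) ?V {1..?N}"
    by (rule bij_betw_trans[OF \<phi> permutes_imp_bij[OF p]])
  then have b': "bij_betw ?\<phi> ?V {1..?N}"
    by (subst bij_betw_cong[of _ _ "p \<circ> \<phi>"]) auto
  then show "?\<phi> \<in> labelings H" by (simp add: labelings_def)
  have inv: "inv_into ?V ?\<phi> (p c) = inv_into ?V \<phi> c" if c: "c \<in> {1..?N}" for c
  proof (rule inv_into_f_eq)
    show "inj_on ?\<phi> ?V" using b' by (simp add: bij_betw_def)
    show m: "inv_into ?V \<phi> c \<in> ?V" using \<phi> c by (metis bij_betw_def inv_into_into)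
    show "?\<phi> (inv_into ?V \<phi> c) = p c"
      using m \<phi> c by (simp add: bij_betw_inv_into_right)
  qed
  have \<kappa>: "\<kappa> v \<in> {1..?N}" if "v \<in> pverts G" for v
    using D that by (auto simp: proper_colorings_def)
  have "p (\<kappa> v) \<in> {1..?N}" if "v \<in> pverts G" for v
    using \<kappa>[OF that] p by (simp only: permutes_in_image)
  then have "restrict (p \<circ> \<kappa>) (pverts G) \<in> pverts G \<rightarrow>\<^sub>E {1..?N}" by auto
  moreover have "(inv_into ?V ?\<phi> (restrict (p \<circ> \<kappa>) (pverts G) u),
      inv_into ?V ?\<phi> (restrict (p \<circ> \<kappa>) (pverts G) v)) \<in> parcs H" if uv: "(u, v) \<in> parcs G" for u v
  proof -
    have "u \<in> pverts G" "v \<in> pverts G"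
      using pair_wf_digraph.in_arcsD1[OF wf uv] pair_wf_digraph.in_arcsD2[OF wf uv] by auto
    then show ?thesis
      using uv D(2) inv[OF \<kappa>, of u] inv[OF \<kappa>, of v] by (simp add: proper_colorings_def)
  qed
  ultimately show "restrict (p \<circ> \<kappa>) (pverts G) \<in> proper_colorings H ?\<phi> G"
    unfolding proper_colorings_def by blast
qed

lemma chrom_poly_symmetric:
  assumes G: "pair_wf_digraph G" "finite (pverts G)" and H: "finite (pverts H)"
    and p: "p permutes {1..card (pverts H)}"
    and ab: "\<And>i. Poly_Mapping.lookup \<beta> (p i) = Poly_Mapping.lookup \<alpha> i"
  shows "Poly_Mapping.lookup (chrom_poly H G) \<alpha> = Poly_Mapping.lookup (chrom_poly H G) \<beta>"
proof -
  let ?D = "Sigma (labelings H) (\<lambda>\<phi>. proper_colorings H \<phi> G)"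
  let ?T = "\<lambda>p (\<phi>, \<kappa>). (restrict (p \<circ> \<phi>) (pverts H), restrict (p \<circ> \<kappa>) (pverts G))"
  note p' = permutes_inv[OF p]
  have mem: "?T q x \<in> ?D" if "x \<in> ?D" "q permutes {1..card (pverts H)}" for x q
    using that relabel_mem[OF that(2) G(1)] by (cases x) auto
  have inv: "?T q (?T r x) = x" if "x \<in> ?D" "\<And>i. q (r i) = i" for x q r
  proof (cases x)
    case (Pair \<phi> \<kappa>)
    then have "\<phi> \<in> extensional (pverts H)" "\<kappa> \<in> extensional (pverts G)"
      using that(1) by (auto simp: labelings_def proper_colorings_def PiE_def)
    then show ?thesis
      using Pair that(2) by (auto simp: fun_eq_iff restrict_def extensional_def)
  qed
  have mon: "coloring_monom G (restrict (p \<circ> \<kappa>) (pverts G)) = \<beta> \<longleftrightarrow> coloring_monom G \<kappa> = \<alpha>" for \<kappa>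
  proof -
    have "Poly_Mapping.lookup (coloring_monom G (restrict (p \<circ> \<kappa>) (pverts G))) (p i) =
        Poly_Mapping.lookup (coloring_monom G \<kappa>) i" for i
    proof -
      have "{v \<in> pverts G. restrict (p \<circ> \<kappa>) (pverts G) v = p i} = {v \<in> pverts G. \<kappa> v = i}"
        using permutes_inj[OF p] by (auto dest: injD)
      then show ?thesis by (simp only: lookup_coloring_monom[OF G(2)])
    qed
    note * = this
    have "coloring_monom G (restrict (p \<circ> \<kappa>) (pverts G)) = \<beta> \<longleftrightarrow>
      (\<forall>i. Poly_Mapping.lookup (coloring_monom G (restrict (p \<circ> \<kappa>) (pverts G))) (p i) =
        Poly_Mapping.lookup \<beta> (p i))"
      using permutes_surj[OF p] by (metis poly_mapping_eqI surjD)
    also have "\<dots> \<longleftrightarrow> coloring_monom G \<kappa> = \<alpha>"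
      by (simp only: * ab) (metis poly_mapping_eqI)
    finally show ?thesis .
  qed
  show ?thesis
    unfolding lookup_chrom_poly[OF G(2) H]
  proof (rule sum.reindex_bij_witness[where i = "?T (inv p)" and j = "?T p"], goal_cases)
    case (1 a) then show ?case
      by (intro inv) (simp_all add: permutes_inverses[OF p])
  next
    case (2 a) then show ?case by (intro mem p)
  next
    case (3 a) then show ?case by (intro inv) (simp_all add: permutes_inverses[OF p])
  next
    case (4 a) then show ?case by (intro mem p')
  next
    case (5 a) then show ?case by (cases a) (simp add: mon)
  qed
qed

lemma exponents_eq_permutes:
  assumes "finite A" "Poly_Mapping.keys \<alpha> \<subseteq> A" "Poly_Mapping.keys \<beta> \<subseteq> A"
    and "exponents \<alpha> = exponents \<beta>"
  obtains p where "p permutes A" "\<And>i. Poly_Mapping.lookup \<beta> (p i) = Poly_Mapping.lookup \<alpha> i"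
proof -
  have split: "image_mset (Poly_Mapping.lookup \<gamma>) (mset_set A) =
      exponents \<gamma> + replicate_mset (card A - size (exponents \<gamma>)) 0"
    if k: "Poly_Mapping.keys \<gamma> \<subseteq> A" for \<gamma> :: monom
  proof -
    have "mset_set A = mset_set (Poly_Mapping.keys \<gamma>) + mset_set (A - Poly_Mapping.keys \<gamma>)"
      using mset_set_Union[of "Poly_Mapping.keys \<gamma>" "A - Poly_Mapping.keys \<gamma>"] k assms(1)
      by (simp add: Un_absorb1)
    moreover have "image_mset (Poly_Mapping.lookup \<gamma>) (mset_set (A - Poly_Mapping.keys \<gamma>)) =
        image_mset (\<lambda>_. 0) (mset_set (A - Poly_Mapping.keys \<gamma>))"
      using assms(1) by (intro image_mset_cong) (auto simp: in_keys_iff)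
    moreover have "card (A - Poly_Mapping.keys \<gamma>) = card A - size (exponents \<gamma>)"
      using k by (simp add: card_Diff_subset exponents_def)
    ultimately show ?thesis by (simp add: exponents_def image_mset_const_eq)
  qed
  have "image_mset (Poly_Mapping.lookup \<alpha>) (mset_set A) = image_mset (Poly_Mapping.lookup \<beta>) (mset_set A)"
    using split[OF assms(2)] split[OF assms(3)] assms(4) by simp
  then obtain p where p: "p permutes A" "\<forall>x\<in>A. Poly_Mapping.lookup \<alpha> x = Poly_Mapping.lookup \<beta> (p x)"
    using image_mset_eq_implies_permutes[OF assms(1)] by metis
  have "Poly_Mapping.lookup \<beta> (p i) = Poly_Mapping.lookup \<alpha> i" for i
  proof (cases "i \<in> A")
    case True then show ?thesis using p(2) by simp
  next
    case False
    then have "p i = i" "i \<notin> Poly_Mapping.keys \<alpha>" "i \<notin> Poly_Mapping.keys \<beta>"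
      using p(1) assms(2,3) by (auto simp: permutes_def)
    then show ?thesis by (simp add: in_keys_iff)
  qed
  with p(1) show thesis using that by blast
qed

lemma lookup_chrom_poly_nonzero:
  assumes "finite (pverts G)" "finite (pverts H)"
    and "Poly_Mapping.lookup (chrom_poly H G) \<alpha> \<noteq> 0"
  shows "Poly_Mapping.keys \<alpha> \<subseteq> {1..card (pverts H)}"
    and "exponents \<alpha> \<in> partitions_le (card (pverts G)) (card (pverts H))"
proof -
  obtain \<phi> \<kappa> where \<kappa>: "\<kappa> \<in> proper_colorings H \<phi> G" "coloring_monom G \<kappa> = \<alpha>"
  proof -
    have "\<exists>x\<in>Sigma (labelings H) (\<lambda>\<phi>. proper_colorings H \<phi> G).
        (case x of (\<phi>, \<kappa>) \<Rightarrow> if coloring_monom G \<kappa> = \<alpha> then 1 else 0) \<noteq> (0 :: int)"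
      using assms(3) unfolding lookup_chrom_poly[OF assms(1,2)] by (meson sum.neutral)
    then show thesis using that by (auto split: if_splits)
  qed
  have l: "Poly_Mapping.lookup \<alpha> i = card {v \<in> pverts G. \<kappa> v = i}" for i
    using lookup_coloring_monom[OF assms(1)] \<kappa>(2) by metis
  have img: "\<kappa> ` pverts G \<subseteq> {1..card (pverts H)}"
    using \<kappa>(1) by (auto simp: proper_colorings_def)
  have k: "Poly_Mapping.keys \<alpha> = \<kappa> ` pverts G"
    using assms(1) by (auto simp: in_keys_iff l)
  then show sub: "Poly_Mapping.keys \<alpha> \<subseteq> {1..card (pverts H)}" using img by simp
  have "sum_mset (exponents \<alpha>) = (\<Sum>i\<in>Poly_Mapping.keys \<alpha>. Poly_Mapping.lookup \<alpha> i)"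
    by (simp add: exponents_def sum_unfold_sum_mset)
  also have "\<dots> = (\<Sum>i\<in>\<kappa> ` pverts G. card {v \<in> pverts G. \<kappa> v = i})" by (simp add: k l)
  also have "\<dots> = card (pverts G)"
    using sum.group[of "pverts G" "\<kappa> ` pverts G" \<kappa> "\<lambda>_. 1 :: nat"] assms(1) by simp
  finally have "sum_mset (exponents \<alpha>) = card (pverts G)" .
  moreover have "0 \<notin># exponents \<alpha>" by (auto simp: exponents_def in_keys_iff)
  moreover have "size (exponents \<alpha>) \<le> card (pverts H)"
    using card_mono[OF _ sub] by (simp add: exponents_def)
  ultimately show "exponents \<alpha> \<in> partitions_le (card (pverts G)) (card (pverts H))"
    by (simp add: partitions_le_def)
qed

text \<open>
  The coefficients selected in the definition of \<^const>\<open>chrom_sym\<close> exist and are unique.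
\<close>

theorem chrom_poly_m_expansion:
  assumes G: "pair_fin_digraph G" and H: "pair_fin_digraph H"
  shows "\<exists>!c. m_expansion (card (pverts G)) (card (pverts H)) (chrom_poly H G) c"
proof -
  let ?k = "card (pverts G)" and ?N = "card (pverts H)" and ?f = "chrom_poly H G"
  have wf: "pair_wf_digraph G" and fG: "finite (pverts G)" and fH: "finite (pverts H)"
    using G H by (auto simp: pair_fin_digraph_def pair_fin_digraph_axioms_def)
  have ex: "\<exists>\<alpha>. Poly_Mapping.keys \<alpha> \<subseteq> {1..?N} \<and> exponents \<alpha> = \<mu>"
    if "\<mu> \<in> partitions_le ?k ?N" for \<mu>
    using that exponents_surj[of \<mu> ?N] unfolding partitions_le_def by blast
  have sym: "Poly_Mapping.lookup ?f \<alpha> = Poly_Mapping.lookup ?f \<beta>"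
    if "Poly_Mapping.keys \<alpha> \<subseteq> {1..?N}" "Poly_Mapping.keys \<beta> \<subseteq> {1..?N}"
      "exponents \<alpha> = exponents \<beta>" for \<alpha> \<beta>
    using exponents_eq_permutes[OF _ that] chrom_poly_symmetric[OF wf fG fH]
    by (metis finite_atLeastAtMost)
  define rep where "rep \<mu> = (SOME \<alpha>. Poly_Mapping.keys \<alpha> \<subseteq> {1..?N} \<and> exponents \<alpha> = \<mu>)" for \<mu>
  have rep: "Poly_Mapping.keys (rep \<mu>) \<subseteq> {1..?N}" "exponents (rep \<mu>) = \<mu>"
    if "\<mu> \<in> partitions_le ?k ?N" for \<mu>
    using someI_ex[OF ex[OF that]] by (simp_all add: rep_def)
  define c where "c \<mu> = (if \<mu> \<in> partitions_le ?k ?N then Poly_Mapping.lookup ?f (rep \<mu>) else 0)" for \<mu>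
  show ?thesis
  proof (rule ex1I[of _ c])
    have "Poly_Mapping.lookup ?f \<alpha> =
        (if Poly_Mapping.keys \<alpha> \<subseteq> {1..?N} \<and> exponents \<alpha> \<in> partitions_le ?k ?N
         then c (exponents \<alpha>) else 0)" for \<alpha>
    proof (cases "Poly_Mapping.keys \<alpha> \<subseteq> {1..?N} \<and> exponents \<alpha> \<in> partitions_le ?k ?N")
      case True
      then show ?thesis using sym[of \<alpha> "rep (exponents \<alpha>)"] rep by (simp add: c_def)
    next
      case False
      then show ?thesis using lookup_chrom_poly_nonzero[OF fG fH, of \<alpha>] by auto
    qed
    then show "m_expansion ?k ?N ?f c" by (simp add: m_expansion_def sum_msym c_def)
  next
    fix d assume d: "m_expansion ?k ?N ?f d"
    show "d = c"
    proof
      fix \<mu> show "d \<mu> = c \<mu>"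
      proof (cases "\<mu> \<in> partitions_le ?k ?N")
        case True
        then have "Poly_Mapping.lookup ?f (rep \<mu>) = d \<mu>"
          using d rep[OF True] by (simp add: m_expansion_def sum_msym)
        then show ?thesis using True by (simp add: c_def)
      next
        case False
        then show ?thesis using d by (simp add: m_expansion_def c_def)
      qed
    qed
  qed
qed

lemma pair_pseudo_graph_aug_star: "pair_pseudo_graph (aug_star n)"
  by unfold_locales
     (auto simp: aug_star_def symmetric_def sym_def arcs_ends_def arc_to_ends_def with_proj_def)

lemma simple_graph_complement: "simple_graph G \<Longrightarrow> simple_graph (complement G)"
proof -
  assume "simple_graph G"
  then interpret pair_graph G by (simp add: simple_graph_def)
  have "finite (parcs (complement G))"
    by (rule finite_subset[of _ "pverts G \<times> pverts G"]) (auto simp: complement_def)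
  then have "pair_graph (complement G)"
    by unfold_locales
       (auto simp: complement_def symmetric_def sym_def dest: arcs_symmetric)
  then show ?thesis
    using \<open>simple_graph G\<close> by (simp add: simple_graph_def complement_def)
qed

end

theory Submission
  imports Defs
begin

text \<open>
  A coloring by the augmented star is proper iff the vertices that do not get the color \<open>c\<close> of the
  center form a stable set, so with \<open>i\<^sub>s\<close> the number of stable sets of size \<open>s\<close> the chromatic
  polynomial is \<open>n! \<Sum>\<^sub>c \<Sum>\<^sub>s i\<^sub>s x\<^sub>c\<^bsup>k-s\<^esup> (\<Sum>\<^sub>j\<^sub>\<noteq>\<^sub>c x\<^sub>j)\<^bsup>s\<^esup>\<close>. The coefficient of \<open>x\<^sup>\<alpha>\<close> is thus a combination
  of the numbers \<open>i\<close> at \<open>k - \<alpha>\<^sub>c\<close> with positive weights that do not depend on the graph. A few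
  monomials recover \<open>i\<^sub>2\<close>, and recover \<open>i\<^sub>3\<close> when it vanishes. A graph is the complement of a
  triangle-free graph with \<open>m\<close> edges iff \<open>i\<^sub>2 = m\<close> and \<open>i\<^sub>3 = 0\<close>, in which
  case all \<open>i\<^sub>s\<close> are known; complements of forests with \<open>j\<close> components are the case \<open>m = k - j\<close>.
\<close>

section \<open>The chromatic polynomial in terms of stable sets\<close>

definition stable_sets :: "'a pair_pre_digraph \<Rightarrow> nat \<Rightarrow> 'a set set" where
  "stable_sets G s = {S. S \<subseteq> pverts G \<and> card S = s \<and> (\<forall>u\<in>S. \<forall>v\<in>S. (u, v) \<notin> parcs G)}"

text \<open>Contribution of one stable set of size \<open>s\<close> in a graph of order
  \<open>k\<close> when the center has color \<open>c\<close>: the stable vertices take arbitrary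
  other colors, the remaining \<open>k - s\<close> vertices take \<open>c\<close>.\<close>

definition star_term :: "nat \<Rightarrow> nat \<Rightarrow> nat \<Rightarrow> nat \<Rightarrow> polynomial" where
  "star_term n k s c = (\<Sum>i\<in>{1..Suc n} - {c}. xvar i) ^ s * xvar c ^ (k - s)"

text \<open>In \<open>star_term n k s c\<close> the exponent of the variable of index
  \<open>c\<close> is always \<open>k - s\<close>, so \<alpha> and \<open>c\<close> determine the
  size of the stable sets that contribute. No graph enters the weight.\<close>

definition star_weight :: "nat \<Rightarrow> nat \<Rightarrow> nat \<Rightarrow> monom \<Rightarrow> int" where
  "star_weight n k c \<alpha> = int (card {\<phi> \<in> labelings (aug_star n). \<phi> 0 = c}) *
     Poly_Mapping.lookup (star_term n k (k - Poly_Mapping.lookup \<alpha> c) c) \<alpha>"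

lemma pverts_aug_star [simp]: "pverts (aug_star n) = {0..n}"
  by (simp add: aug_star_def)

lemma simple_graphD:
  assumes "simple_graph G"
  shows "finite (pverts G)" "pair_graph G" "pair_fin_digraph G" "pverts G \<noteq> {}"
proof -
  show "pair_graph G" "pverts G \<noteq> {}" using assms by (auto simp: simple_graph_def)
  then interpret pair_graph G by simp
  show "finite (pverts G)" "pair_fin_digraph G" by auto
qed

section \<open>Coefficients of a single star term\<close>

lemma sum_PiE_star_term:
  assumes "finite V" "S \<subseteq> V"
  shows "(\<Sum>\<kappa>\<in>PiE V (\<lambda>v. if v \<in> S then {1..Suc n} - {c} else {c}). \<Prod>v\<in>V. xvar (\<kappa> v)) =
    star_term n (card V) (card S) c"
proof -
  \<comment> \<open>The index set consists of the maps for which \<open>S\<close> is exactly the set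
    of vertices not colored \<open>c\<close>. Colors are chosen independently, so the sum factors
    over the vertices.\<close>
  have "(\<Sum>\<kappa>\<in>PiE V (\<lambda>v. if v \<in> S then {1..Suc n} - {c} else {c}). \<Prod>v\<in>V. xvar (\<kappa> v)) =
      (\<Prod>v\<in>V. \<Sum>i\<in>(if v \<in> S then {1..Suc n} - {c} else {c}). xvar i)"
    by (rule prod_sum_PiE[symmetric]) (use assms in auto)
  also have "\<dots> = (\<Prod>v\<in>V. if v \<in> S then \<Sum>i\<in>{1..Suc n} - {c}. xvar i else xvar c)"
    by (rule prod.cong) auto
  also have "\<dots> = star_term n (card V) (card S) c"
    using assms by (simp add: prod.If_cases star_term_def Int_absorb1 card_Diff_subset
        finite_subset flip: Diff_eq)
  finally show ?thesis .
qed

text \<open>Expanding the powers gives one monomial for each word of length \<open>k\<close> whose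
  first \<open>s\<close> letters avoid \<open>c\<close> and whose other letters are
  \<open>c\<close>. Coefficients thus become cardinalities.\<close>

lemma lookup_star_term:
  assumes "s \<le> k"
  shows "Poly_Mapping.lookup (star_term n k s c) \<alpha> =
    int (card {\<kappa> \<in> PiE {..<k} (\<lambda>v. if v \<in> {..<s} then {1..Suc n} - {c} else {c}).
      \<forall>i. card {v \<in> {..<k}. \<kappa> v = i} = Poly_Mapping.lookup \<alpha> i})"
proof -
  \<comment> \<open>An edgeless graph on the positions of the word, so that
    \<open>coloring_monom\<close> and \<open>prod_xvar\<close> apply.\<close>
  let ?G = "\<lparr>pverts = {..<k}, parcs = {}\<rparr> :: nat pair_pre_digraph"
  let ?P = "PiE {..<k} (\<lambda>v. if v \<in> {..<s} then {1..Suc n} - {c} else {c})"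
  have fin: "finite ?P" by (rule finite_PiE) auto
  have "star_term n k s c = (\<Sum>\<kappa>\<in>?P. \<Prod>v\<in>pverts ?G. xvar (\<kappa> v))"
    using sum_PiE_star_term[of "{..<k}" "{..<s}" n c] assms by simp
  also have "\<dots> = (\<Sum>\<kappa>\<in>?P. Poly_Mapping.single (coloring_monom ?G \<kappa>) 1)"
    by (subst prod_xvar) auto
  finally have "Poly_Mapping.lookup (star_term n k s c) \<alpha> =
      (\<Sum>\<kappa>\<in>?P. if coloring_monom ?G \<kappa> = \<alpha> then 1 else 0)"
    by (simp only: lookup_sum lookup_single when_def)
  also have "\<dots> = int (card {\<kappa> \<in> ?P. coloring_monom ?G \<kappa> = \<alpha>})"
    using fin by (simp add: sum.If_cases Int_def)
  also have "{\<kappa> \<in> ?P. coloring_monom ?G \<kappa> = \<alpha>} =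
      {\<kappa> \<in> ?P. \<forall>i. card {v \<in> {..<k}. \<kappa> v = i} = Poly_Mapping.lookup \<alpha> i}"
    using lookup_coloring_monom[of ?G] by (auto intro!: poly_mapping_eqI)
  finally show ?thesis .
qed

lemma lookup_star_term_eq_0:
  assumes "s \<le> k" "Poly_Mapping.lookup \<alpha> c \<noteq> k - s"
  shows "Poly_Mapping.lookup (star_term n k s c) \<alpha> = 0"
proof -
  have False if \<kappa>: "\<kappa> \<in> PiE {..<k} (\<lambda>v. if v \<in> {..<s} then {1..Suc n} - {c} else {c})"
    "\<forall>i. card {v \<in> {..<k}. \<kappa> v = i} = Poly_Mapping.lookup \<alpha> i" for \<kappa>
  proof -
    have "\<kappa> v = c \<longleftrightarrow> s \<le> v" if "v < k" for v
      using PiE_mem[OF \<kappa>(1), of v] that by (auto split: if_splits)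
    then have "{v \<in> {..<k}. \<kappa> v = c} = {s..<k}" by (intro set_eqI) fastforce
    then show False using \<kappa>(2) assms(2) by (metis card_atLeastLessThan)
  qed
  then have "{\<kappa> \<in> PiE {..<k} (\<lambda>v. if v \<in> {..<s} then {1..Suc n} - {c} else {c}).
      \<forall>i. card {v \<in> {..<k}. \<kappa> v = i} = Poly_Mapping.lookup \<alpha> i} = {}" by blast
  then show ?thesis by (simp only: lookup_star_term[OF assms(1)] card.empty)
qed

text \<open>One word with content \<alpha> suffices: write the colors other than \<open>c\<close>
  first, each with its multiplicity, then fill up with \<open>c\<close>.\<close>

lemma lookup_star_term_pos:
  assumes "Poly_Mapping.keys \<alpha> \<subseteq> {1..Suc n}" "c \<in> {1..Suc n}"
    and "(\<Sum>i\<in>{1..Suc n}. Poly_Mapping.lookup \<alpha> i) = k"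
  shows "Poly_Mapping.lookup (star_term n k (k - Poly_Mapping.lookup \<alpha> c) c) \<alpha> > 0"
proof -
  let ?I = "{1..Suc n}" and ?l = "Poly_Mapping.lookup \<alpha>"
  define s where "s = k - ?l c"
  \<comment> \<open>The degree hypothesis makes the truncated subtraction in \<open>s\<close>
    exact.\<close>
  have k: "k = ?l c + (\<Sum>i\<in>?I - {c}. ?l i)"
    using assms(2,3) sum.remove[of ?I c ?l] by simp
  then have s: "s = (\<Sum>i\<in>?I - {c}. ?l i)" "s \<le> k" "k - s = ?l c" by (auto simp: s_def)
  obtain xs where xs: "mset xs = (\<Sum>i\<in>?I - {c}. replicate_mset (?l i) i)" by (metis ex_mset)
  have len: "length xs = s"
    using arg_cong[OF xs, of size] by (simp add: s(1))
  have count_xs: "count (mset xs) i = (if i \<in> ?I - {c} then ?l i else 0)" for i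
  proof -
    have "count (mset xs) i = (\<Sum>j\<in>?I - {c}. if j = i then ?l j else 0)"
      unfolding xs count_sum by (rule sum.cong) auto
    then show ?thesis by simp
  qed
  define \<kappa> where "\<kappa> v = (if v < s then xs ! v else if v < k then c else undefined)" for v
  have nth_xs: "xs ! v \<in> ?I - {c}" if "v < s" for v
  proof -
    have "count (mset xs) (xs ! v) \<noteq> 0"
      using that len by (metis count_eq_zero_iff nth_mem_mset)
    then show ?thesis by (simp only: count_xs split: if_splits)
  qed
  then have mem: "\<kappa> \<in> PiE {..<k} (\<lambda>v. if v \<in> {..<s} then ?I - {c} else {c})"
    using s(2) by (intro PiE_I) (auto simp: \<kappa>_def simp del: atLeastAtMost_iff)
  have cnt: "card {v \<in> {..<k}. \<kappa> v = i} = ?l i" for i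
  proof (cases "i = c")
    case True
    have "\<kappa> v = c \<longleftrightarrow> s \<le> v" if "v < k" for v
      using that nth_xs[of v] by (cases "v < s") (auto simp: \<kappa>_def)
    then have "{v \<in> {..<k}. \<kappa> v = c} = {s..<k}" by (intro set_eqI) fastforce
    then show ?thesis using True s(3) by simp
  next
    case False
    have "{v \<in> {..<k}. \<kappa> v = i} = {v. v < length xs \<and> i = xs ! v}"
      using False s(2) len by (auto simp: \<kappa>_def)
    then have "card {v \<in> {..<k}. \<kappa> v = i} = count (mset xs) i"
      by (simp only: count_mset count_list_eq_length_filter length_filter_conv_card)
    \<comment> \<open>A color outside \<open>{1..Suc n}\<close> has exponent 0 by the hypothesis on
      the keys.\<close>
    also have "\<dots> = ?l i"
      using assms(1) False by (auto simp: count_xs in_keys_iff)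
    finally show ?thesis .
  qed
  let ?K = "{\<kappa> \<in> PiE {..<k} (\<lambda>v. if v \<in> {..<s} then ?I - {c} else {c}).
      \<forall>i. card {v \<in> {..<k}. \<kappa> v = i} = ?l i}"
  have "finite (PiE {..<k} (\<lambda>v. if v \<in> {..<s} then ?I - {c} else {c}))"
    by (rule finite_PiE) auto
  then have "finite ?K" by (rule rev_finite_subset) auto
  moreover have "\<kappa> \<in> ?K" using mem cnt by blast
  ultimately have "card ?K > 0" by (auto simp: card_gt_0_iff)
  then show ?thesis by (simp only: lookup_star_term[OF s(2)] s_def[symmetric] of_nat_0_less_iff)
qed

section \<open>Labelings and proper colorings of the augmented star\<close>

lemma labeling_center:
  assumes "\<phi> \<in> labelings (aug_star n)"
  shows "\<phi> 0 \<in> {1..Suc n}"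
  using assms bij_betwE[of \<phi> "{0..n}" "{1..Suc n}"] by (auto simp: labelings_def)

lemma card_labelings_center_pos:
  assumes "c \<in> {1..Suc n}"
  shows "card {\<phi> \<in> labelings (aug_star n). \<phi> 0 = c} > 0"
proof -
  \<comment> \<open>\<open>Suc\<close> sends the center 0 to 1, and the transposition moves 1 to
    \<open>c\<close>.\<close>
  define \<phi> where "\<phi> = restrict (transpose 1 c \<circ> Suc) {0..n}"
  have "bij_betw Suc {0..n} {1..Suc n}" by (auto simp: bij_betw_def image_Suc_atLeastAtMost)
  moreover have "bij_betw (transpose 1 c) {1..Suc n} {1..Suc n}"
    using assms by (intro permutes_imp_bij permutes_swap_id) auto
  ultimately have "bij_betw (transpose 1 c \<circ> Suc) {0..n} {1..Suc n}" by (rule bij_betw_trans)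
  then have "bij_betw \<phi> {0..n} {1..Suc n}"
    unfolding \<phi>_def by (subst bij_betw_cong[of _ _ "transpose 1 c \<circ> Suc"]) auto
  then have "\<phi> \<in> {\<phi> \<in> labelings (aug_star n). \<phi> 0 = c}"
    by (auto simp: labelings_def \<phi>_def)
  moreover have "finite {\<phi> \<in> labelings (aug_star n). \<phi> 0 = c}"
    using finite_labelings[of "aug_star n"] by simp
  ultimately show ?thesis by (auto simp: card_gt_0_iff)
qed

lemma star_weight_pos:
  assumes "Poly_Mapping.keys \<alpha> \<subseteq> {1..Suc n}" "c \<in> {1..Suc n}"
    and "(\<Sum>i\<in>{1..Suc n}. Poly_Mapping.lookup \<alpha> i) = k"
  shows "star_weight n k c \<alpha> > 0"
  unfolding star_weight_def
  using card_labelings_center_pos[OF assms(2)] lookup_star_term_pos[OF assms] by simp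

text \<open>Two vertices of the augmented star are adjacent iff one of them is the center; the loop
  covers the case that both are. Hence properness only forbids an edge whose two ends both avoid the
  color \<open>\<phi> 0\<close>.\<close>

lemma proper_colorings_aug_star:
  assumes G: "simple_graph G" and \<phi>: "\<phi> \<in> labelings (aug_star n)"
  shows "proper_colorings (aug_star n) \<phi> G =
    (\<Union>S\<in>{S. S \<subseteq> pverts G \<and> (\<forall>u\<in>S. \<forall>v\<in>S. (u, v) \<notin> parcs G)}.
       PiE (pverts G) (\<lambda>v. if v \<in> S then {1..Suc n} - {\<phi> 0} else {\<phi> 0}))"
proof -
  interpret pair_graph G using G by (rule simple_graphD)
  have bij: "bij_betw \<phi> {0..n} {1..Suc n}" using \<phi> by (simp add: labelings_def)
  have inv: "inv_into {0..n} \<phi> i \<in> {0..n}" "inv_into {0..n} \<phi> i = 0 \<longleftrightarrow> i = \<phi> 0"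
    if "i \<in> {1..Suc n}" for i
  proof -
    show "inv_into {0..n} \<phi> i \<in> {0..n}"
      using bij that by (metis bij_betw_def inv_into_into)
    show "inv_into {0..n} \<phi> i = 0 \<longleftrightarrow> i = \<phi> 0"
      using bij_betw_inv_into_right[OF bij that] bij_betw_inv_into_left[OF bij, of 0] by auto
  qed
  have arc: "(inv_into {0..n} \<phi> i, inv_into {0..n} \<phi> j) \<in> parcs (aug_star n) \<longleftrightarrow>
      i = \<phi> 0 \<or> j = \<phi> 0" if "i \<in> {1..Suc n}" "j \<in> {1..Suc n}" for i j
    unfolding inv(2)[OF that(1), symmetric] inv(2)[OF that(2), symmetric]
    using inv(1)[OF that(1)] inv(1)[OF that(2)] by (auto simp: aug_star_def)
  have "\<kappa> \<in> proper_colorings (aug_star n) \<phi> G \<longleftrightarrow>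
      \<kappa> \<in> pverts G \<rightarrow>\<^sub>E {1..Suc n} \<and> (\<forall>u v. (u, v) \<in> parcs G \<longrightarrow> \<kappa> u = \<phi> 0 \<or> \<kappa> v = \<phi> 0)" for \<kappa>
  proof -
    have "\<kappa> u \<in> {1..Suc n} \<and> \<kappa> v \<in> {1..Suc n}"
      if "\<kappa> \<in> pverts G \<rightarrow>\<^sub>E {1..Suc n}" "(u, v) \<in> parcs G" for u v
      using that in_arcsD1 in_arcsD2 by (meson PiE_mem)
    then show ?thesis
      unfolding proper_colorings_def pverts_aug_star using arc
      by (simp del: atLeastAtMost_iff) (smt (verit) arc)
  qed
  note proper = this
  show ?thesis
  proof (intro set_eqI iffI)
    fix \<kappa> assume \<kappa>: "\<kappa> \<in> proper_colorings (aug_star n) \<phi> G"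
    let ?S = "{v \<in> pverts G. \<kappa> v \<noteq> \<phi> 0}"
    have "\<kappa> \<in> PiE (pverts G) (\<lambda>v. if v \<in> ?S then {1..Suc n} - {\<phi> 0} else {\<phi> 0})"
      using \<kappa> unfolding proper by (auto simp: PiE_iff)
    moreover have "\<forall>u\<in>?S. \<forall>v\<in>?S. (u, v) \<notin> parcs G" using \<kappa> unfolding proper by blast
    ultimately show "\<kappa> \<in> (\<Union>S\<in>{S. S \<subseteq> pverts G \<and> (\<forall>u\<in>S. \<forall>v\<in>S. (u, v) \<notin> parcs G)}.
       PiE (pverts G) (\<lambda>v. if v \<in> S then {1..Suc n} - {\<phi> 0} else {\<phi> 0}))"
      by (intro UN_I[of ?S]) auto
  next
    fix \<kappa> assume "\<kappa> \<in> (\<Union>S\<in>{S. S \<subseteq> pverts G \<and> (\<forall>u\<in>S. \<forall>v\<in>S. (u, v) \<notin> parcs G)}.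
       PiE (pverts G) (\<lambda>v. if v \<in> S then {1..Suc n} - {\<phi> 0} else {\<phi> 0}))"
    then obtain S where S: "S \<subseteq> pverts G" "\<forall>u\<in>S. \<forall>v\<in>S. (u, v) \<notin> parcs G"
      and \<kappa>: "\<kappa> \<in> PiE (pverts G) (\<lambda>v. if v \<in> S then {1..Suc n} - {\<phi> 0} else {\<phi> 0})" by blast
    have "\<kappa> v \<in> {1..Suc n}" "v \<notin> S \<Longrightarrow> \<kappa> v = \<phi> 0" if "v \<in> pverts G" for v
      using PiE_mem[OF \<kappa> that] labeling_center[OF \<phi>] by (auto split: if_splits)
    moreover have "\<kappa> \<in> extensional (pverts G)" using \<kappa> by (auto simp: PiE_def)
    ultimately show "\<kappa> \<in> proper_colorings (aug_star n) \<phi> G"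
      unfolding proper PiE_iff using S(2) in_arcsD1 in_arcsD2 by blast
  qed
qed

text \<open>Sort the proper colorings by the set of vertices that avoid the center's color, then
  sort these stable sets by size.\<close>

lemma lookup_chrom_poly_aug_star:
  assumes G: "simple_graph G"
  shows "Poly_Mapping.lookup (chrom_poly (aug_star n) G) \<alpha> =
    (\<Sum>\<phi>\<in>labelings (aug_star n). \<Sum>s\<le>card (pverts G). int (card (stable_sets G s)) *
       Poly_Mapping.lookup (star_term n (card (pverts G)) s (\<phi> 0)) \<alpha>)"
proof -
  let ?V = "pverts G" and ?k = "card (pverts G)"
  let ?St = "{S. S \<subseteq> pverts G \<and> (\<forall>u\<in>S. \<forall>v\<in>S. (u, v) \<notin> parcs G)}"
  have fin: "finite ?V" using G by (rule simple_graphD)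
  then have finSt: "finite ?St" by auto
  have "(\<Sum>\<kappa>\<in>proper_colorings (aug_star n) \<phi> G. \<Prod>v\<in>?V. xvar (\<kappa> v)) =
      (\<Sum>S\<in>?St. star_term n ?k (card S) (\<phi> 0))" if \<phi>: "\<phi> \<in> labelings (aug_star n)" for \<phi>
  proof -
    let ?P = "\<lambda>S. PiE ?V (\<lambda>v. if v \<in> S then {1..Suc n} - {\<phi> 0} else {\<phi> 0})"
    \<comment> \<open>A coloring determines its stable set as the vertices not colored
      \<open>\<phi> 0\<close>.\<close>
    have disj: "?P S \<inter> ?P T = {}" if "S \<in> ?St" "T \<in> ?St" "S \<noteq> T" for S T
    proof (rule equals0I)
      fix \<kappa> assume "\<kappa> \<in> ?P S \<inter> ?P T"
      then have \<kappa>: "\<kappa> \<in> ?P S" "\<kappa> \<in> ?P T" by auto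
      have "v \<in> S \<longleftrightarrow> v \<in> T" if "v \<in> ?V" for v
        using PiE_mem[OF \<kappa>(1) that] PiE_mem[OF \<kappa>(2) that] by (auto split: if_splits)
      then show False using that by blast
    qed
    have "(\<Sum>\<kappa>\<in>proper_colorings (aug_star n) \<phi> G. \<Prod>v\<in>?V. xvar (\<kappa> v)) =
        (\<Sum>S\<in>?St. \<Sum>\<kappa>\<in>?P S. \<Prod>v\<in>?V. xvar (\<kappa> v))"
      unfolding proper_colorings_aug_star[OF G \<phi>]
      by (rule sum.UNION_disjoint) (use finSt fin disj in \<open>auto intro!: finite_PiE\<close>)
    also have "\<dots> = (\<Sum>S\<in>?St. star_term n ?k (card S) (\<phi> 0))"
      by (rule sum.cong) (use sum_PiE_star_term[OF fin] in auto)
    finally show ?thesis .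
  qed
  then have "Poly_Mapping.lookup (chrom_poly (aug_star n) G) \<alpha> =
      (\<Sum>\<phi>\<in>labelings (aug_star n). \<Sum>S\<in>?St.
        Poly_Mapping.lookup (star_term n ?k (card S) (\<phi> 0)) \<alpha>)"
    by (simp add: chrom_poly_def lookup_sum)
  moreover have "(\<Sum>S\<in>?St. Poly_Mapping.lookup (star_term n ?k (card S) c) \<alpha>) =
      (\<Sum>s\<le>?k. int (card (stable_sets G s)) * Poly_Mapping.lookup (star_term n ?k s c) \<alpha>)" for c
  proof -
    have "card ` ?St \<subseteq> {..?k}" using fin by (auto intro: card_mono)
    then have "(\<Sum>S\<in>?St. Poly_Mapping.lookup (star_term n ?k (card S) c) \<alpha>) =
      (\<Sum>s\<le>?k. \<Sum>S\<in>{S \<in> ?St. card S = s}. Poly_Mapping.lookup (star_term n ?k (card S) c) \<alpha>)"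
      by (intro sum.group[symmetric] finSt) auto
    also have "\<dots> = (\<Sum>s\<le>?k. \<Sum>S\<in>stable_sets G s. Poly_Mapping.lookup (star_term n ?k s c) \<alpha>)"
      by (intro sum.cong) (auto simp: stable_sets_def)
    finally show ?thesis by simp
  qed
  ultimately show ?thesis by simp
qed

text \<open>For each center color only one size \<open>s\<close> survives. Grouping the labelings by
  the color of the center then gives a linear form in the stable set counts whose coefficients are
  the same for all graphs of order \<open>k\<close>.\<close>

lemma lookup_chrom_poly_aug_star_weight:
  assumes G: "simple_graph G" and k: "card (pverts G) = k"
    and \<alpha>: "(\<Sum>i\<in>{1..Suc n}. Poly_Mapping.lookup \<alpha> i) = k"
  shows "Poly_Mapping.lookup (chrom_poly (aug_star n) G) \<alpha> =
    (\<Sum>c\<in>{1..Suc n}. int (card (stable_sets G (k - Poly_Mapping.lookup \<alpha> c))) *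
      star_weight n k c \<alpha>)"
proof -
  let ?l = "Poly_Mapping.lookup \<alpha>"
  let ?t = "\<lambda>c. int (card (stable_sets G (k - ?l c))) *
    Poly_Mapping.lookup (star_term n k (k - ?l c) c) \<alpha>"
  have inner: "(\<Sum>s\<le>k. int (card (stable_sets G s)) * Poly_Mapping.lookup (star_term n k s c) \<alpha>) = ?t c"
    if c: "c \<in> {1..Suc n}" for c
  proof -
    have le: "?l c \<le> k" using \<alpha> c by (metis finite_atLeastAtMost member_le_sum zero_le)
    have "(\<Sum>s\<le>k. int (card (stable_sets G s)) * Poly_Mapping.lookup (star_term n k s c) \<alpha>) =
        (\<Sum>s\<in>{k - ?l c}. int (card (stable_sets G s)) * Poly_Mapping.lookup (star_term n k s c) \<alpha>)"
      using le by (intro sum.mono_neutral_right) (auto intro!: lookup_star_term_eq_0)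
    then show ?thesis by simp
  qed
  have "Poly_Mapping.lookup (chrom_poly (aug_star n) G) \<alpha> =
      (\<Sum>\<phi>\<in>labelings (aug_star n). ?t (\<phi> 0))"
    unfolding lookup_chrom_poly_aug_star[OF G] k
    by (rule sum.cong) (auto intro!: inner dest: labeling_center)
  also have "\<dots> = (\<Sum>c\<in>{1..Suc n}. \<Sum>\<phi>\<in>{\<phi> \<in> labelings (aug_star n). \<phi> 0 = c}. ?t (\<phi> 0))"
    by (rule sum.group[symmetric]) (auto simp: finite_labelings dest: labeling_center)
  also have "\<dots> = (\<Sum>c\<in>{1..Suc n}. int (card (stable_sets G (k - ?l c))) * star_weight n k c \<alpha>)"
    by (intro sum.cong) (auto simp: star_weight_def)
  finally show ?thesis .
qed

section \<open>From the polynomial to the symmetric function\<close>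

lemma chrom_sym_eq_lookup:
  assumes G: "pair_fin_digraph G" and H: "pair_fin_digraph H"
    and \<alpha>: "Poly_Mapping.keys \<alpha> \<subseteq> {1..card (pverts H)}"
  shows "chrom_sym H G \<alpha> = Poly_Mapping.lookup (chrom_poly H G) \<alpha>"
proof -
  let ?k = "card (pverts G)" and ?N = "card (pverts H)"
  define c where "c = (THE c. m_expansion ?k ?N (chrom_poly H G) c)"
  have "m_expansion ?k ?N (chrom_poly H G) c"
    unfolding c_def by (rule theI'[OF chrom_poly_m_expansion[OF G H]])
  \<comment> \<open>On monomials in the first \<open>?N\<close> variables, a monomial symmetric
    function and its restriction to those variables have the same coefficients.\<close>
  moreover have "Poly_Mapping.keys \<alpha> \<subseteq> {1..}" using \<alpha> by auto
  ultimately show ?thesis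
    using \<alpha> unfolding chrom_sym_def Let_def c_def[symmetric] m_expansion_def by (simp add: sum_msym)
qed

text \<open>The expansion of the chromatic polynomial sees the graph only through its order and its
  stable set counts.\<close>

lemma chrom_sym_aug_star_cong:
  assumes "simple_graph G1" "simple_graph G2" "card (pverts G1) = card (pverts G2)"
    and "\<And>s. card (stable_sets G1 s) = card (stable_sets G2 s)"
  shows "chrom_sym (aug_star n) G1 = chrom_sym (aug_star n) G2"
proof -
  have "chrom_poly (aug_star n) G1 = chrom_poly (aug_star n) G2"
    by (rule poly_mapping_eqI) (simp add: lookup_chrom_poly_aug_star assms)
  then show ?thesis by (simp add: chrom_sym_def assms(3))
qed

lemma chrom_sym_aug_star_weight:
  assumes G: "simple_graph G" and k: "card (pverts G) = k"
    and \<alpha>: "Poly_Mapping.keys \<alpha> \<subseteq> {1..Suc n}" "(\<Sum>i\<in>{1..Suc n}. Poly_Mapping.lookup \<alpha> i) = k"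
  shows "chrom_sym (aug_star n) G \<alpha> =
    (\<Sum>c\<in>{1..Suc n}. int (card (stable_sets G (k - Poly_Mapping.lookup \<alpha> c))) *
      star_weight n k c \<alpha>)"
proof -
  have "pair_fin_digraph (aug_star n)"
    using pair_pseudo_graph_aug_star pair_pseudo_graph.axioms(1) by blast
  then have "chrom_sym (aug_star n) G \<alpha> = Poly_Mapping.lookup (chrom_poly (aug_star n) G) \<alpha>"
    using \<alpha>(1) by (intro chrom_sym_eq_lookup simple_graphD(3)[OF G]) simp_all
  then show ?thesis using lookup_chrom_poly_aug_star_weight[OF G k \<alpha>(2)] by simp
qed

section \<open>Recovering the numbers of stable sets\<close>

lemma finite_stable_sets: "finite (pverts G) \<Longrightarrow> finite (stable_sets G s)"
  by (rule finite_subset[of _ "Pow (pverts G)"]) (auto simp: stable_sets_def)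

lemma card_stable_sets_0:
  assumes "simple_graph G"
  shows "card (stable_sets G 0) = 1"
proof -
  have "stable_sets G 0 = {{}}"
    using simple_graphD(1)[OF assms] by (auto simp: stable_sets_def dest: finite_subset)
  then show ?thesis by simp
qed

lemma card_stable_sets_1:
  assumes "simple_graph G"
  shows "card (stable_sets G 1) = card (pverts G)"
proof -
  interpret pair_graph G using assms by (rule simple_graphD)
  have "stable_sets G 1 = (\<lambda>v. {v}) ` pverts G"
    by (auto simp: stable_sets_def card_1_singleton_iff dest: no_loops')
  then show ?thesis by (simp add: card_image)
qed

lemma stable_sets_2:
  assumes "simple_graph G"
  shows "stable_sets G 2 = uedges (complement G)"
proof -
  interpret pair_graph G using assms by (rule simple_graphD)
  show ?thesis
  proof (intro set_eqI iffI)
    fix S assume "S \<in> stable_sets G 2"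
    then have "S \<subseteq> pverts G" "card S = 2" "\<forall>u\<in>S. \<forall>v\<in>S. (u, v) \<notin> parcs G"
      by (auto simp: stable_sets_def)
    moreover from this obtain u v where "S = {u, v}" "u \<noteq> v" by (auto simp: card_2_iff)
    ultimately show "S \<in> uedges (complement G)" by (auto simp: uedges_def complement_def)
  next
    fix S assume "S \<in> uedges (complement G)"
    then obtain u v where "S = {u, v}" "u \<in> pverts G" "v \<in> pverts G" "u \<noteq> v" "(u, v) \<notin> parcs G"
      by (auto simp: uedges_def complement_def)
    then show "S \<in> stable_sets G 2"
      by (auto simp: stable_sets_def dest: arcs_symmetric no_loops')
  qed
qed

text \<open>A pair of distinct vertices is either an edge or stable, never both. For graphs of equal
  order, the number of stable pairs therefore determines the number of edges.\<close>

lemma card_uedges_plus_card_stable_sets_2: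
  assumes "simple_graph G"
  shows "card (uedges G) + card (stable_sets G 2) = card (pverts G) choose 2"
proof -
  interpret pair_graph G using assms by (rule simple_graphD)
  have fin: "finite (pverts G)" by (rule simple_graphD(1)[OF assms])
  have edge: "card S = 2 \<and> S \<subseteq> pverts G" if "S \<in> uedges G" for S
    using that by (auto simp: uedges_def card_2_iff dest: no_loops' in_arcsD1 in_arcsD2)
  have Un: "uedges G \<union> stable_sets G 2 = {S. S \<subseteq> pverts G \<and> card S = 2}"
  proof (intro set_eqI iffI)
    fix S assume "S \<in> uedges G \<union> stable_sets G 2"
    then show "S \<in> {S. S \<subseteq> pverts G \<and> card S = 2}"
      using edge by (auto simp: stable_sets_def)
  next
    fix S assume "S \<in> {S. S \<subseteq> pverts G \<and> card S = 2}"
    moreover from this obtain u v where "S = {u, v}" "u \<noteq> v" by (auto simp: card_2_iff)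
    ultimately show "S \<in> uedges G \<union> stable_sets G 2"
      unfolding stable_sets_2[OF assms] by (auto simp: uedges_def complement_def)
  qed
  have "uedges G \<inter> stable_sets G 2 = {}" by (auto simp: stable_sets_def uedges_def)
  moreover have "finite (uedges G \<union> stable_sets G 2)" unfolding Un using fin by simp
  ultimately have "card (uedges G) + card (stable_sets G 2) = card (uedges G \<union> stable_sets G 2)"
    by (simp add: card_Un_disjoint)
  also have "\<dots> = card (pverts G) choose 2" unfolding Un using fin by (rule n_subsets)
  finally show ?thesis .
qed

lemma C3_free_complement_iff:
  assumes "simple_graph G"
  shows "C3_free (complement G) \<longleftrightarrow> stable_sets G 3 = {}"
proof -
  interpret pair_graph G using assms by (rule simple_graphD)
  show ?thesis
  proof
    assume C3: "C3_free (complement G)"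
    show "stable_sets G 3 = {}"
    proof (rule equals0I)
      fix S assume "S \<in> stable_sets G 3"
      then have S: "S \<subseteq> pverts G" "card S = 3" "\<forall>u\<in>S. \<forall>v\<in>S. (u, v) \<notin> parcs G"
        by (auto simp: stable_sets_def)
      moreover from this obtain u v w where "S = {u, v, w}" "u \<noteq> v" "v \<noteq> w" "u \<noteq> w"
        by (auto simp: card_3_iff)
      ultimately show False using C3 by (auto simp: C3_free_def complement_def)
    qed
  next
    assume st: "stable_sets G 3 = {}"
    show "C3_free (complement G)"
      unfolding C3_free_def
    proof (rule notI, elim exE conjE)
      fix u v w assume *: "distinct [u, v, w]" "(u, v) \<in> parcs (complement G)"
        "(v, w) \<in> parcs (complement G)" "(w, u) \<in> parcs (complement G)"
      then have "{u, v, w} \<in> stable_sets G 3"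
        by (auto simp: stable_sets_def complement_def dest: arcs_symmetric no_loops')
      then show False using st by blast
    qed
  qed
qed

text \<open>Subsets of stable sets are stable. Thus a graph without stable triples has no larger
  stable sets either.\<close>

lemma stable_sets_empty_mono:
  assumes "finite (pverts G)" "stable_sets G s = {}" "s \<le> t"
  shows "stable_sets G t = {}"
proof (rule equals0I)
  fix S assume S: "S \<in> stable_sets G t"
  then obtain T where "T \<subseteq> S" "card T = s"
    using assms(3) obtain_subset_with_card_n[of s S] by (auto simp: stable_sets_def)
  then have "T \<in> stable_sets G s" using S by (auto simp: stable_sets_def)
  then show False using assms(2) by blast
qed

lemma complement_complement:
  assumes "simple_graph G"
  shows "complement (complement G) = G"
proof -
  interpret pair_graph G using assms by (rule simple_graphD)
  show ?thesis
    by (rule pair_pre_digraph.equality)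
       (auto simp: complement_def in_arcsD1 in_arcsD2 dest: no_loops')
qed

lemma pverts_complement [simp]: "pverts (complement G) = pverts G"
  by (simp add: complement_def)

section \<open>Linear relations between the counts\<close>

lemma weighted_sum_eq_0_same_sign:
  fixes f w :: "'i \<Rightarrow> int"
  assumes "(\<Sum>i\<in>I. f i * w i) = 0" "finite I" "\<And>i. i \<in> I \<Longrightarrow> w i > 0"
    and "(\<forall>i\<in>I. f i \<ge> 0) \<or> (\<forall>i\<in>I. f i \<le> 0)" "j \<in> I"
  shows "f j = 0"
proof -
  have "f j = 0" if "\<forall>i\<in>I. f i \<ge> 0" "(\<Sum>i\<in>I. f i * w i) = 0" for f
  proof -
    \<comment> \<open>Nonnegative terms with sum 0 all vanish; the nonpositive case follows by
      negating \<open>f\<close>.\<close>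
    have "f i * w i \<ge> 0" if "i \<in> I" for i
      using \<open>\<forall>i\<in>I. f i \<ge> 0\<close> assms(3)[OF that] that by simp
    then have "f j * w j = 0"
      using that(2) assms(2,5) by (simp add: sum_nonneg_eq_0_iff)
    then show ?thesis using assms(3)[OF assms(5)] by simp
  qed
  from this[of f] this[of "\<lambda>i. - f i"] show ?thesis
    using assms(1,4) by (auto simp: sum_negf)
qed

text \<open>
  The monomials \<open>x\<^sub>1\<^sup>k\<close>, \<open>x\<^sub>1\<^sup>k\<^sup>-\<^sup>1x\<^sub>2\<close>, \<open>x\<^sub>1\<^sup>k\<^sup>-\<^sup>2x\<^sub>2x\<^sub>3\<close> and \<open>x\<^sub>1\<^sup>k\<^sup>-\<^sup>3x\<^sub>2\<^sup>3\<close> isolate, in this order,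
  the values of \<open>D\<close> at \<open>k\<close>, \<open>k - 1\<close>, \<open>2\<close> and \<open>3\<close>. The last one also involves \<open>D (k - 3)\<close>,
  which is why nonnegativity is needed there.
\<close>

lemma weighted_relations_vanish:
  fixes D :: "nat \<Rightarrow> int" and W :: "nat \<Rightarrow> monom \<Rightarrow> int"
  assumes n: "n \<ge> 2" and k: "k \<ge> 1" and D0: "D 0 = 0" and D1: "D 1 = 0"
    and W: "\<And>\<alpha> c. Poly_Mapping.keys \<alpha> \<subseteq> {1..Suc n} \<Longrightarrow> c \<in> {1..Suc n} \<Longrightarrow>
      (\<Sum>i\<in>{1..Suc n}. Poly_Mapping.lookup \<alpha> i) = k \<Longrightarrow> W c \<alpha> > 0"
    and rel: "\<And>\<alpha>. Poly_Mapping.keys \<alpha> \<subseteq> {1..Suc n} \<Longrightarrow>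
      (\<Sum>i\<in>{1..Suc n}. Poly_Mapping.lookup \<alpha> i) = k \<Longrightarrow>
      (\<Sum>c\<in>{1..Suc n}. D (k - Poly_Mapping.lookup \<alpha> c) * W c \<alpha>) = 0"
  shows "k \<ge> 2 \<Longrightarrow> D 2 = 0"
    and "k \<ge> 3 \<Longrightarrow> (\<And>s. D s \<ge> 0) \<Longrightarrow> D 3 = 0"
proof -
  \<comment> \<open>Exponents of
    \<open>x\<^sub>1\<^sup>a x\<^sub>2\<^sup>b x\<^sub>3\<^sup>d\<close> as a function of the
    variable; \<open>n \<ge> 2\<close> provides these three variables.\<close>
  define e :: "nat \<Rightarrow> nat \<Rightarrow> nat \<Rightarrow> nat \<Rightarrow> nat"
    where "e a b d c = (if c = 1 then a else if c = 2 then b else if c = 3 then d else 0)" for a b d c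
  \<comment> \<open>One relation forces every value of \<open>D\<close> occurring in it to vanish,
    as soon as these values have a common sign.\<close>
  have vanish: "D (k - e a b d c) = 0"
    if "a + b + d = k" "c \<in> {1..Suc n}"
      and sg: "(\<forall>c. D (k - e a b d c) \<ge> 0) \<or> (\<forall>c. D (k - e a b d c) \<le> 0)" for a b c d
  proof -
    define \<alpha> :: monom where
      "\<alpha> = Poly_Mapping.single 1 a + Poly_Mapping.single 2 b + Poly_Mapping.single 3 d"
    have l: "Poly_Mapping.lookup \<alpha> = e a b d"
      by (auto simp: \<alpha>_def e_def lookup_add lookup_single when_def)
    have keys: "Poly_Mapping.keys \<alpha> \<subseteq> {1..Suc n}"
      using n by (auto simp: in_keys_iff l e_def split: if_splits)
    have "(\<Sum>i\<in>{1..Suc n}. e a b d i) = (\<Sum>i\<in>{1, 2, 3}. e a b d i)"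
      using n by (intro sum.mono_neutral_right) (auto simp: e_def)
    then have deg: "(\<Sum>i\<in>{1..Suc n}. Poly_Mapping.lookup \<alpha> i) = k"
      unfolding l using that(1) by (simp add: e_def)
    have "(\<Sum>c\<in>{1..Suc n}. D (k - e a b d c) * W c \<alpha>) = 0"
      using rel[OF keys deg] by (simp only: l)
    then show ?thesis
      by (rule weighted_sum_eq_0_same_sign[where w = "\<lambda>c. W c \<alpha>", OF _ finite_atLeastAtMost])
         (use W[OF keys _ deg] sg that(2) in auto)
  qed
  have mem: "1 \<in> {1..Suc n}" "2 \<in> {1..Suc n}" using n by auto
  \<comment> \<open>Index 1 gives \<open>D 0 = 0\<close> and every other index gives
    \<open>D k\<close>, so the sign is common whatever it is.\<close>
  have "(\<forall>c. D (k - e k 0 0 c) \<ge> 0) \<or> (\<forall>c. D (k - e k 0 0 c) \<le> 0)"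
    using D0 linear[of "D k" 0] by (auto simp: e_def)
  from vanish[OF _ mem(2) this] have Dk: "D k = 0" by (simp add: e_def)
  have Dk1: "D (k - 1) = 0" if "k \<ge> 2"
  proof -
    \<comment> \<open>The values are \<open>D 1 = 0\<close>, \<open>D (k - 1)\<close> and
      \<open>D k = 0\<close>.\<close>
    have "(\<forall>c. D (k - e (k - 1) 1 0 c) \<ge> 0) \<or> (\<forall>c. D (k - e (k - 1) 1 0 c) \<le> 0)"
      using D1 Dk linear[of "D (k - 1)" 0] k by (auto simp: e_def)
    from vanish[OF _ mem(2) this] show ?thesis using k by (simp add: e_def)
  qed
  have D2: "D 2 = 0" if "k \<ge> 2"
  proof (cases "k = 2")
    case True
    then show ?thesis using Dk by simp
  next
    case False
    \<comment> \<open>Index 1 gives \<open>D 2\<close>, indices 2 and 3 give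
      \<open>D (k - 1) = 0\<close>, and all others give \<open>D k = 0\<close>.\<close>
    then have "(\<forall>c. D (k - e (k - 2) 1 1 c) \<ge> 0) \<or> (\<forall>c. D (k - e (k - 2) 1 1 c) \<le> 0)"
      using Dk Dk1 linear[of "D 2" 0] that by (auto simp: e_def)
    from vanish[OF _ mem(1) this] show ?thesis using that False by (simp add: e_def)
  qed
  then show "k \<ge> 2 \<Longrightarrow> D 2 = 0" .
  assume "k \<ge> 3" "\<And>s. D s \<ge> 0"
  then show "D 3 = 0"
    using vanish[of "k - 3" 3 0 1] mem(1) by (auto simp: e_def)
qed

text \<open>The power of the first variable with exponent the order of \<open>G1\<close> has a
  nonzero coefficient, and the polynomial of \<open>G2\<close> is homogeneous of degree the order of
  \<open>G2\<close>.\<close>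

lemma chrom_sym_aug_star_card_pverts:
  assumes G: "simple_graph G1" "simple_graph G2"
    and eq: "chrom_sym (aug_star n) G1 = chrom_sym (aug_star n) G2"
  shows "card (pverts G1) = card (pverts G2)"
proof -
  let ?k = "card (pverts G1)" and ?\<alpha> = "Poly_Mapping.single 1 (card (pverts G1)) :: monom"
  have k: "?k > 0" using simple_graphD[OF G(1)] by (simp add: card_gt_0_iff)
  have l: "Poly_Mapping.lookup ?\<alpha> = (\<lambda>i. if i = 1 then ?k else 0)"
    by (auto simp: lookup_single when_def)
  have keys: "Poly_Mapping.keys ?\<alpha> \<subseteq> {1..Suc n}" by simp
  have deg: "(\<Sum>i\<in>{1..Suc n}. Poly_Mapping.lookup ?\<alpha> i) = ?k" unfolding l by (subst sum.delta) auto
  have fin: "pair_fin_digraph (aug_star n)"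
    using pair_pseudo_graph_aug_star pair_pseudo_graph.axioms(1) by blast
  \<comment> \<open>All summands are nonnegative, and the one for center color 1 counts the empty
    stable set.\<close>
  have "chrom_sym (aug_star n) G1 ?\<alpha> \<ge>
      int (card (stable_sets G1 (?k - Poly_Mapping.lookup ?\<alpha> 1))) * star_weight n ?k 1 ?\<alpha>"
    unfolding chrom_sym_aug_star_weight[OF G(1) refl keys deg]
    by (rule member_le_sum)
       (use less_imp_le[OF star_weight_pos[OF keys _ deg]] in \<open>auto intro!: mult_nonneg_nonneg\<close>)
  moreover have "star_weight n ?k 1 ?\<alpha> > 0" by (rule star_weight_pos[OF keys _ deg]) simp
  ultimately have "chrom_sym (aug_star n) G1 ?\<alpha> \<noteq> 0"
    using card_stable_sets_0[OF G(1)] by (simp add: l)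
  then have "Poly_Mapping.lookup (chrom_poly (aug_star n) G2) ?\<alpha> \<noteq> 0"
    using chrom_sym_eq_lookup[OF simple_graphD(3)[OF G(2)] fin, of ?\<alpha>] keys eq by simp
  then have "exponents ?\<alpha> \<in> partitions_le (card (pverts G2)) (Suc n)"
    using lookup_chrom_poly_nonzero(2)[of G2 "aug_star n"] simple_graphD(1)[OF G(2)] by simp
  then show ?thesis using k by (simp add: partitions_le_def exponents_def)
qed

lemma card_pverts_gt_0: "simple_graph G \<Longrightarrow> card (pverts G) > 0"
  using simple_graphD by (auto simp: card_gt_0_iff)

lemma stable_sets_empty_of_card_less:
  assumes "finite (pverts G)" "card (pverts G) < s"
  shows "stable_sets G s = {}"
  using assms card_mono[OF assms(1)] by (fastforce simp: stable_sets_def)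

lemma chrom_sym_aug_star_stable_sets:
  assumes n: "n \<ge> 2" and G: "simple_graph G1" "simple_graph G2"
    and eq: "chrom_sym (aug_star n) G1 = chrom_sym (aug_star n) G2"
  shows "card (stable_sets G1 2) = card (stable_sets G2 2)"
    and "stable_sets G1 3 = {} \<Longrightarrow> stable_sets G2 3 = {}"
proof -
  define k where "k = card (pverts G1)"
  have k: "card (pverts G1) = k" "card (pverts G2) = k" "k \<ge> 1"
    using chrom_sym_aug_star_card_pverts[OF G eq] card_pverts_gt_0[OF G(1)]
    by (auto simp: k_def)
  note fin = simple_graphD(1)[OF G(1)] simple_graphD(1)[OF G(2)]
  \<comment> \<open>Equal symmetric functions turn the differences of counts into a solution of the
    homogeneous relations. The order of subtraction makes \<open>D\<close> nonnegative once
    \<open>G1\<close> has no stable triples.\<close>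
  define D where "D s = int (card (stable_sets G2 s)) - int (card (stable_sets G1 s))" for s
  have D01: "D 0 = 0" "D 1 = 0"
    using card_stable_sets_0[OF G(1)] card_stable_sets_0[OF G(2)]
      card_stable_sets_1[OF G(1)] card_stable_sets_1[OF G(2)] k by (simp_all add: D_def)
  have rel: "(\<Sum>c\<in>{1..Suc n}. D (k - Poly_Mapping.lookup \<alpha> c) * star_weight n k c \<alpha>) = 0"
    if \<alpha>: "Poly_Mapping.keys \<alpha> \<subseteq> {1..Suc n}" "(\<Sum>i\<in>{1..Suc n}. Poly_Mapping.lookup \<alpha> i) = k" for \<alpha>
    using chrom_sym_aug_star_weight[OF G(1) k(1) \<alpha>] chrom_sym_aug_star_weight[OF G(2) k(2) \<alpha>] eq
    by (simp only: D_def left_diff_distrib sum_subtractf)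
  note van = weighted_relations_vanish[of n k D "star_weight n k", OF n k(3) D01 star_weight_pos rel]
  show 2: "card (stable_sets G1 2) = card (stable_sets G2 2)"
  proof (cases "k \<ge> 2")
    case True
    then show ?thesis using van(1) by (simp add: D_def)
  next
    case False
    then show ?thesis using k fin by (simp add: stable_sets_empty_of_card_less)
  qed
  assume 3: "stable_sets G1 3 = {}"
  show "stable_sets G2 3 = {}"
  proof (cases "k \<ge> 3")
    case True
    \<comment> \<open>Below 3 the counts agree; from 3 on \<open>G1\<close> contributes 0.\<close>
    have "D s \<ge> 0" for s
    proof -
      consider "s = 0" | "s = 1" | "s = 2" | "s \<ge> 3" by linarith
      then show ?thesis
      proof cases
        case 4
        then show ?thesis using stable_sets_empty_mono[OF fin(1) 3] by (simp add: D_def)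
      qed (use D01 2 in \<open>auto simp: D_def\<close>)
    qed
    then have "D 3 = 0" using van(2) True by blast
    then show ?thesis using 3 finite_stable_sets[OF fin(2)] by (simp add: D_def)
  next
    case False
    then show ?thesis using k fin by (simp add: stable_sets_empty_of_card_less)
  qed
qed

section \<open>Complements of triangle-free graphs\<close>

lemma co_C3_free_graphs_iff:
  "G \<in> co_C3_free_graphs k m \<longleftrightarrow> simple_graph G \<and> card (pverts G) = k \<and>
     card (stable_sets G 2) = m \<and> stable_sets G 3 = {}"
proof
  assume "G \<in> co_C3_free_graphs k m"
  then obtain G' where G': "G = complement G'" "simple_graph G'" "card (pverts G') = k"
    "card (uedges G') = m" "C3_free G'" by (auto simp: co_C3_free_graphs_def)
  moreover have "simple_graph G" using G' by (simp add: simple_graph_complement)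
  \<comment> \<open>Complementation is an involution, so edges and triangles of \<open>G'\<close>
    are stable pairs and triples of \<open>G\<close>.\<close>
  moreover have "complement G = G'" using G' by (simp add: complement_complement)
  ultimately show "simple_graph G \<and> card (pverts G) = k \<and>
     card (stable_sets G 2) = m \<and> stable_sets G 3 = {}"
    using stable_sets_2[of G] C3_free_complement_iff[of G] by simp
next
  assume G: "simple_graph G \<and> card (pverts G) = k \<and>
     card (stable_sets G 2) = m \<and> stable_sets G 3 = {}"
  then show "G \<in> co_C3_free_graphs k m"
    unfolding co_C3_free_graphs_def
    using stable_sets_2[of G] C3_free_complement_iff[of G]
    by (intro CollectI exI[of _ "complement G"])
       (simp add: complement_complement simple_graph_complement)
qed

text \<open>All counts are prescribed: 1, \<open>k\<close> and \<open>m\<close> for sizes 0, 1 and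
  2, and 0 from size 3 on.\<close>

lemma chrom_sym_co_C3_free_graphs:
  assumes "G1 \<in> co_C3_free_graphs k m" "G2 \<in> co_C3_free_graphs k m"
  shows "chrom_sym (aug_star n) G1 = chrom_sym (aug_star n) G2"
proof (rule chrom_sym_aug_star_cong)
  show G: "simple_graph G1" "simple_graph G2" and k: "card (pverts G1) = card (pverts G2)"
    using assms by (auto simp: co_C3_free_graphs_iff)
  fix s :: nat
  consider "s = 0" | "s = 1" | "s = 2" | "s \<ge> 3" by linarith
  then show "card (stable_sets G1 s) = card (stable_sets G2 s)"
  proof cases
    case 4
    then show ?thesis
      using stable_sets_empty_mono[of G1 3 s] stable_sets_empty_mono[of G2 3 s]
        assms simple_graphD(1)[OF G(1)] simple_graphD(1)[OF G(2)]
      by (auto simp: co_C3_free_graphs_iff)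
  qed (use assms card_stable_sets_0[OF G(1)] card_stable_sets_0[OF G(2)]
      card_stable_sets_1[OF G(1)] card_stable_sets_1[OF G(2)] k
      in \<open>auto simp: co_C3_free_graphs_iff\<close>)
qed

section \<open>Forests\<close>

text \<open>The last hypothesis says that every edge is a bridge. Deleting a bridge splits one class
  into two and removes one edge, so the sum is unchanged; without edges the classes are
  singletons.\<close>

lemma card_rtrancl_classes_forest:
  assumes "finite V" "E \<subseteq> V \<times> V" "sym E"
    and "\<And>u v. (u, v) \<in> E \<Longrightarrow> (u, v) \<notin> (E - {(u, v), (v, u)})\<^sup>*"
  shows "card ((\<lambda>u. E\<^sup>* `` {u}) ` V) + card {{u, v} | u v. (u, v) \<in> E} = card V"
proof -
  have "finite E" using assms(1,2) by (meson finite_SigmaI finite_subset)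
  then show ?thesis using assms(2-)
  proof (induction E rule: finite_psubset_induct)
    case (psubset E)
    show ?case
    proof (cases "E = {}")
      case True
      then show ?thesis by (simp add: card_image)
    next
      case False
      then obtain a b where ab: "(a, b) \<in> E" by auto
      then have abV: "a \<in> V" "b \<in> V" and ba: "(b, a) \<in> E"
        using psubset.prems by (auto dest: symD)
      define E' where "E' = E - {(a, b), (b, a)}"
      define R where "R = E'\<^sup>*"
      have E: "E = insert (a, b) (insert (b, a) E')" using ab ba by (auto simp: E'_def)
      have symE': "sym E'" using psubset.prems(2) by (auto simp: E'_def sym_def)
      have sym: "(x, y) \<in> R \<Longrightarrow> (y, x) \<in> R" for x y
        using sym_rtrancl[OF symE'] unfolding R_def by (meson symD)
      have trans: "(x, y) \<in> R \<Longrightarrow> (y, z) \<in> R \<Longrightarrow> (x, z) \<in> R" for x y z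
        unfolding R_def by (rule rtrancl_trans)
      have refl: "(x, x) \<in> R" for x by (simp add: R_def)
      have nab: "(a, b) \<notin> R" using psubset.prems(3)[OF ab] by (simp add: R_def E'_def)
      have IH: "card ((\<lambda>u. R `` {u}) ` V) + card {{u, v} | u v. (u, v) \<in> E'} = card V"
        unfolding R_def
      proof (rule psubset.IH)
        show "E' \<subset> E" using ab by (auto simp: E'_def)
        show "E' \<subseteq> V \<times> V" using psubset.prems(1) by (auto simp: E'_def)
        show "sym E'" by (rule symE')
        fix u v assume uv: "(u, v) \<in> E'"
        \<comment> \<open>Bridges stay bridges in a smaller relation.\<close>
        have "(E' - {(u, v), (v, u)})\<^sup>* \<subseteq> (E - {(u, v), (v, u)})\<^sup>*"
          by (rule rtrancl_mono) (auto simp: E'_def)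
        then show "(u, v) \<notin> (E' - {(u, v), (v, u)})\<^sup>*"
          using psubset.prems(3)[of u v] uv by (auto simp: E'_def)
      qed
      \<comment> \<open>Restoring the edge lets a path cross between the classes of \<open>a\<close>
        and \<open>b\<close>, and changes nothing else.\<close>
      have reach: "(x, y) \<in> E\<^sup>* \<longleftrightarrow>
          (x, y) \<in> R \<or> (x, a) \<in> R \<and> (b, y) \<in> R \<or> (x, b) \<in> R \<and> (a, y) \<in> R" for x y
        unfolding E rtrancl_insert R_def[symmetric]
        by simp (meson sym trans refl)
      let ?c = "\<lambda>u. R `` {u}"
      have cls: "E\<^sup>* `` {u} = (if u \<in> ?c a \<union> ?c b then ?c a \<union> ?c b else ?c u)" for u
        by (rule set_eqI, simp add: reach) (meson sym trans refl)
      have eq_c: "?c u = ?c v \<longleftrightarrow> (u, v) \<in> R" for u v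
      proof
        show "?c u = ?c v \<Longrightarrow> (u, v) \<in> R" using refl[of v] by auto
        show "(u, v) \<in> R \<Longrightarrow> ?c u = ?c v" by (auto intro: trans dest: sym)
      qed
      have 1: "(\<lambda>u. E\<^sup>* `` {u}) ` V = insert (?c a \<union> ?c b) (?c ` V - {?c a, ?c b})"
        (is "?L = ?R")
      proof
        show "?L \<subseteq> ?R"
        proof
          fix X assume "X \<in> ?L"
          then obtain u where u: "u \<in> V" "X = E\<^sup>* `` {u}" by auto
          show "X \<in> ?R"
          proof (cases "u \<in> ?c a \<union> ?c b")
            case True
            then show ?thesis using u cls[of u] by simp
          next
            case False
            then have "?c u \<noteq> ?c a" "?c u \<noteq> ?c b" using refl[of u] by auto
            then show ?thesis using u False cls[of u] by simp
          qed
        qed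
        have "?c a \<union> ?c b \<in> ?L" using abV(1) refl[of a] cls[of a] by (metis ImageI UnI1 imageI singletonI)
        moreover have "?c u \<in> ?L" if "u \<in> V" "?c u \<noteq> ?c a" "?c u \<noteq> ?c b" for u
        proof -
          have "u \<notin> ?c a \<union> ?c b" using that by (auto simp: eq_c dest: sym)
          then have "E\<^sup>* `` {u} = ?c u" by (simp add: cls)
          then show ?thesis using that(1) by (metis imageI)
        qed
        ultimately show "?R \<subseteq> ?L" by auto
      qed
      \<comment> \<open>A class equal to this union would contain both \<open>a\<close> and
        \<open>b\<close>, contradicting that their edge is a bridge.\<close>
      have 2: "?c a \<union> ?c b \<notin> ?c ` V - {?c a, ?c b}"
      proof
        assume "?c a \<union> ?c b \<in> ?c ` V - {?c a, ?c b}"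
        then obtain u where u: "?c a \<union> ?c b = ?c u" by auto
        then have "(u, a) \<in> R" "(u, b) \<in> R" using refl by blast+
        then show False using nab sym trans by meson
      qed
      have 3: "?c a \<noteq> ?c b" using nab by (simp add: eq_c)
      have "card {?c a, ?c b} \<le> card (?c ` V)"
        using assms(1) abV by (intro card_mono) auto
      then have 4: "card (?c ` V) = card ((\<lambda>u. E\<^sup>* `` {u}) ` V) + 1"
        unfolding 1 using assms(1) 2 3 abV by (simp add: card_Diff_subset)
      have 5: "{{u, v} | u v. (u, v) \<in> E} = insert {a, b} {{u, v} | u v. (u, v) \<in> E'}"
        unfolding E by blast
      have 6: "{a, b} \<notin> {{u, v} | u v. (u, v) \<in> E'}"
        by (auto simp: E'_def doubleton_eq_iff)
      have "finite {{u, v} | u v. (u, v) \<in> E'}"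
        by (rule finite_subset[of _ "(\<lambda>(u, v). {u, v}) ` E"])
           (use psubset.hyps in \<open>auto simp: E'_def\<close>)
      then have "card {{u, v} | u v. (u, v) \<in> E} = card {{u, v} | u v. (u, v) \<in> E'} + 1"
        unfolding 5 using 6 by simp
      then show ?thesis using IH 4 by linarith
    qed
  qed
qed

section \<open>Components and cycles of undirected forests\<close>

lemma (in pair_wf_digraph) reachable_iff_rtrancl:
  "reachable (with_proj G) u v \<longleftrightarrow> u \<in> pverts G \<and> (u, v) \<in> (parcs G)\<^sup>*"
proof
  assume r: "reachable (with_proj G) u v"
  then show "u \<in> pverts G \<and> (u, v) \<in> (parcs G)\<^sup>*"
    using reachable_in_verts(1)[OF r] reachable_rtranclI[OF r] by simp
next
  assume "u \<in> pverts G \<and> (u, v) \<in> (parcs G)\<^sup>*"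
  then have "(u, v) \<in> (parcs G)\<^sup>*" "u \<in> pverts G" by auto
  then show "reachable (with_proj G) u v"
    by (induction rule: rtrancl_induct) (auto intro: reachable_adj_trans)
qed

lemma components_eq_rtrancl_classes:
  assumes "simple_graph G"
  shows "components G = (\<lambda>u. (parcs G)\<^sup>* `` {u}) ` pverts G"
proof -
  interpret pair_graph G using assms by (simp add: simple_graph_def)
  let ?R = "(parcs G)\<^sup>*"
  have "sym (parcs G)" by (auto intro: symI arcs_symmetric)
  then have sym: "(x, y) \<in> ?R \<Longrightarrow> (y, x) \<in> ?R" for x y by (meson sym_rtrancl symD)
  have V: "(x, y) \<in> ?R \<Longrightarrow> x \<in> pverts G \<Longrightarrow> y \<in> pverts G" for x y
    by (induction rule: rtrancl_induct) (auto intro: in_arcsD2)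
  show ?thesis
  proof (intro set_eqI iffI)
    fix S assume "S \<in> components G"
    then have S: "S \<noteq> {}" "\<And>u v. u \<in> S \<Longrightarrow> v \<in> S \<Longrightarrow> u \<in> pverts G \<and> (u, v) \<in> ?R"
      "\<And>u v. u \<in> S \<Longrightarrow> u \<in> pverts G \<Longrightarrow> v \<in> pverts G \<Longrightarrow> (u, v) \<in> ?R \<Longrightarrow> v \<in> S"
      using sym by (auto simp: components_def sccs_verts_def reachable_iff_rtrancl)
    then obtain u where u: "u \<in> S" by blast
    then have "S = ?R `` {u}" "u \<in> pverts G" using S(2,3) V by blast+
    then show "S \<in> (\<lambda>u. ?R `` {u}) ` pverts G" by blast
  next
    fix S assume "S \<in> (\<lambda>u. ?R `` {u}) ` pverts G"
    then obtain u where u: "u \<in> pverts G" "S = ?R `` {u}" by blast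
    show "S \<in> components G"
      unfolding components_def sccs_verts_def reachable_iff_rtrancl u(2)
      using u(1) V by (auto dest: sym intro: rtrancl_trans)
  qed
qed

text \<open>A simple path from \<open>u\<close> to \<open>v\<close> that avoids the edge would close
  up with the arc \<open>(v, u)\<close> to a cycle.\<close>

lemma undirected_forest_bridge:
  assumes "undirected_forest G" "(u, v) \<in> parcs G"
  shows "(u, v) \<notin> (parcs G - {(u, v), (v, u)})\<^sup>*"
proof
  assume r: "(u, v) \<in> (parcs G - {(u, v), (v, u)})\<^sup>*"
  interpret pair_graph G using assms by (simp add: undirected_forest_def simple_graph_def)
  \<comment> \<open>The graph without this edge, in which reachability supplies a path with distinct
    vertices.\<close>
  define G' where "G' = \<lparr>pverts = pverts G, parcs = parcs G - {(u, v), (v, u)}\<rparr>"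
  interpret G': pair_wf_digraph G'
    by unfold_locales (auto simp: G'_def intro: in_arcsD1 in_arcsD2)
  have "reachable (with_proj G') u v"
    unfolding G'.reachable_iff_rtrancl using r in_arcsD1[OF assms(2)] by (simp add: G'_def)
  then obtain p where "G'.apath u p v" using G'.reachable_apath by auto
  then have p: "set p \<subseteq> parcs G - {(u, v), (v, u)}" "pcas u p v" "distinct (pawalk_verts u p)"
    by (auto simp: G'.apath_def G'.awalk_def) (auto simp: G'_def)
  \<comment> \<open>An empty path would mean \<open>u = v\<close>, hence a loop, and a single arc
    would be the deleted \<open>(u, v)\<close>. The closed walk thus has length at least 3.\<close>
  have len: "2 \<le> length p"
  proof (cases p)
    case Nil
    then show ?thesis using p(2) no_loops'[OF assms(2)] by simp
  next
    case (Cons e q)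
    then show ?thesis using p(1,2) by (cases q) auto
  qed
  have "cycle ((v, u) # p)"
    using p arcs_symmetric[OF assms(2)] in_arcsD2[OF assms(2)]
    by (auto simp: cycle_def awalk_def)
  then show False using assms(1) len by (auto simp: undirected_forest_def)
qed

lemma undirected_forest_C3_free:
  assumes "undirected_forest G"
  shows "C3_free G"
  unfolding C3_free_def
proof (rule notI, elim exE conjE)
  interpret pair_graph G using assms by (simp add: undirected_forest_def simple_graph_def)
  fix u v w assume "distinct [u, v, w]" "(u, v) \<in> parcs G" "(v, w) \<in> parcs G" "(w, u) \<in> parcs G"
  then have "cycle [(u, v), (v, w), (w, u)]"
    by (auto simp: cycle_def awalk_def intro: in_arcsD1)
  then show False using assms unfolding undirected_forest_def by force
qed

lemma undirected_forest_card:
  assumes "undirected_forest G"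
  shows "card (components G) + card (uedges G) = card (pverts G)"
proof -
  have sg: "simple_graph G" using assms by (simp add: undirected_forest_def)
  then interpret pair_graph G by (simp add: simple_graph_def)
  show ?thesis
    unfolding components_eq_rtrancl_classes[OF sg] uedges_def
    by (rule card_rtrancl_classes_forest)
       (auto intro: symI arcs_symmetric in_arcsD1 in_arcsD2 dest: undirected_forest_bridge[OF assms])
qed

lemma undirected_tree_card_components:
  assumes "undirected_tree G"
  shows "card (components G) = 1"
proof -
  have sg: "simple_graph G" using assms by (simp add: undirected_tree_def undirected_forest_def)
  then interpret pair_graph G by (simp add: simple_graph_def)
  \<comment> \<open>\<open>connected\<close> refers to the symmetric closure, which is
    \<open>G\<close> itself.\<close>
  have "mk_symmetric (with_proj G) = G"
    by (rule pair_pre_digraph.equality) (auto simp: mk_symmetric_def, blast dest: arcs_symmetric)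
  then have "strongly_connected (with_proj G)"
    using assms by (simp add: undirected_tree_def connected_def)
  then have "(u, v) \<in> (parcs G)\<^sup>*" if "u \<in> pverts G" "v \<in> pverts G" for u v
    using that by (auto simp: reachable_iff_rtrancl)
  moreover have "v \<in> pverts G" if "(u, v) \<in> (parcs G)\<^sup>*" "u \<in> pverts G" for u v
    using that by (induction rule: rtrancl_induct) (auto intro: in_arcsD2)
  ultimately have "(parcs G)\<^sup>* `` {u} = pverts G" if "u \<in> pverts G" for u
    using that by blast
  then have "components G = {pverts G}"
    using sg by (auto simp: components_eq_rtrancl_classes simple_graph_def)
  then show ?thesis by simp
qed

text \<open>A forest has no triangle, and \<open>k\<close> vertices with \<open>j\<close> components
  leave \<open>k - j\<close> edges.\<close>

lemma co_forests_subset: "co_forests k j \<subseteq> co_C3_free_graphs k (k - j)"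
proof
  fix G :: "'a pair_pre_digraph" assume "G \<in> co_forests k j"
  then obtain T where T: "G = complement T" "undirected_forest T" "card (pverts T) = k"
    "card (components T) = j" by (auto simp: co_forests_def)
  moreover have "card (uedges T) = k - j" using undirected_forest_card[OF T(2)] T(3,4) by simp
  ultimately show "G \<in> co_C3_free_graphs k (k - j)"
    using undirected_forest_C3_free[OF T(2)]
    by (auto simp: co_C3_free_graphs_def undirected_forest_def)
qed

section \<open>Edge counts, complements of triangle-free graphs, forests and trees\<close>

theorem corollary6p6:
  fixes n k :: nat
  assumes "n \<ge> 2"
  shows
    "(\<forall>(G1 :: 'a pair_pre_digraph) (G2 :: 'b pair_pre_digraph).
        simple_graph G1 \<and> simple_graph G2 \<and> card (pverts G1) = k \<and> card (pverts G2) = k \<and>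
        chrom_sym (aug_star n) G1 = chrom_sym (aug_star n) G2 \<longrightarrow>
        card (uedges G1) = card (uedges G2))
     \<and>
     (\<forall>m :: nat. \<forall>G1 \<in> (co_C3_free_graphs k m :: 'a pair_pre_digraph set).
        (\<forall>G2 \<in> (co_C3_free_graphs k m :: 'b pair_pre_digraph set).
           chrom_sym (aug_star n) G1 = chrom_sym (aug_star n) G2) \<and>
        (\<forall>G2 :: 'b pair_pre_digraph. simple_graph G2 \<and> G2 \<notin> co_C3_free_graphs k m \<longrightarrow>
           chrom_sym (aug_star n) G1 \<noteq> chrom_sym (aug_star n) G2))
     \<and>
     (\<forall>j \<in> {1..k}. \<forall>G1 \<in> (co_forests k j :: 'a pair_pre_digraph set).
        \<forall>G2 \<in> (co_forests k j :: 'b pair_pre_digraph set).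
          chrom_sym (aug_star n) G1 = chrom_sym (aug_star n) G2)
     \<and>
     (\<forall>(T1 :: 'a pair_pre_digraph) (T2 :: 'b pair_pre_digraph).
        undirected_tree T1 \<and> undirected_tree T2 \<and> card (pverts T1) = card (pverts T2) \<longrightarrow>
        chrom_sym (aug_star n) (complement T1) = chrom_sym (aug_star n) (complement T2))"
proof (intro conjI allI impI ballI)
  fix G1 :: "'a pair_pre_digraph" and G2 :: "'b pair_pre_digraph"
  assume *: "simple_graph G1 \<and> simple_graph G2 \<and> card (pverts G1) = k \<and> card (pverts G2) = k \<and>
    chrom_sym (aug_star n) G1 = chrom_sym (aug_star n) G2"
  then have "card (stable_sets G1 2) = card (stable_sets G2 2)"
    using chrom_sym_aug_star_stable_sets(1)[OF assms] by blast
  then show "card (uedges G1) = card (uedges G2)"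
    using * card_uedges_plus_card_stable_sets_2[of G1] card_uedges_plus_card_stable_sets_2[of G2] by simp
next
  fix m and G1 :: "'a pair_pre_digraph" and G2 :: "'b pair_pre_digraph"
  assume "G1 \<in> co_C3_free_graphs k m" "G2 \<in> co_C3_free_graphs k m"
  then show "chrom_sym (aug_star n) G1 = chrom_sym (aug_star n) G2"
    by (rule chrom_sym_co_C3_free_graphs)
next
  fix m and G1 :: "'a pair_pre_digraph" and G2 :: "'b pair_pre_digraph"
  assume G1: "G1 \<in> co_C3_free_graphs k m" and G2: "simple_graph G2 \<and> G2 \<notin> co_C3_free_graphs k m"
  show "chrom_sym (aug_star n) G1 \<noteq> chrom_sym (aug_star n) G2"
  proof
    assume eq: "chrom_sym (aug_star n) G1 = chrom_sym (aug_star n) G2"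
    have "simple_graph G1" "simple_graph G2" using G1 G2 by (auto simp: co_C3_free_graphs_iff)
    \<comment> \<open>Equality fixes the order, the number of stable pairs and the absence of stable
      triples, so \<open>G2\<close> would belong to the family.\<close>
    note facts = chrom_sym_aug_star_card_pverts[OF this eq]
      chrom_sym_aug_star_stable_sets[OF assms this eq]
    show False using facts G1 G2 by (simp add: co_C3_free_graphs_iff)
  qed
next
  fix j and G1 :: "'a pair_pre_digraph" and G2 :: "'b pair_pre_digraph"
  assume "G1 \<in> co_forests k j" "G2 \<in> co_forests k j"
  then show "chrom_sym (aug_star n) G1 = chrom_sym (aug_star n) G2"
    by (intro chrom_sym_co_C3_free_graphs[of _ k "k - j"] subsetD[OF co_forests_subset])
next
  fix T1 :: "'a pair_pre_digraph" and T2 :: "'b pair_pre_digraph"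
  assume *: "undirected_tree T1 \<and> undirected_tree T2 \<and> card (pverts T1) = card (pverts T2)"
  let ?k = "card (pverts T1)"
  \<comment> \<open>A tree is a forest with one component.\<close>
  have "complement T1 \<in> co_forests ?k 1" "complement T2 \<in> co_forests ?k 1"
    using * by (auto simp: co_forests_def undirected_tree_def undirected_tree_card_components)
  then show "chrom_sym (aug_star n) (complement T1) = chrom_sym (aug_star n) (complement T2)"
    by (intro chrom_sym_co_C3_free_graphs[of _ ?k "?k - 1"] subsetD[OF co_forests_subset])
qed

end
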